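(* Let $0<q<p\le 1$ be fixed. For positive integers $n,\Delta$, consider the Markovian model started from $\mathsf{SBM}(n+\Delta,n,p,q)$ (with $n+\Delta$ vertices of opinion $+$ and $n$ vertices of opinion $-$), and let $\mathscr P$ be the event that opinion $+$ wins eventually. (i) There exists a constant $L=L(p,q)>0$ such that, uniformly for all integers $\Delta>0$ and $n\in\mathbb N$, $$\mathbb P(\mathscr P)\ge \frac12+\frac1L .$$ (ii) If $\Delta=\Delta_n$ satisfies $\Delta_n\to\infty$ as $n\to\infty$, then $\mathbb P(\mathscr P)\to 1$ as $n\to\infty$.
   Context: $\mathbb N=\{1,2,\dots\}$, $\mathbb N_0=\mathbb N\cup\{0\}$. Stochastic block model: $\mathsf{SBM}(m,n,p,q)$ is the random graph on $m+n$ vertices, each carrying a label $W_i\in\{-1,+1\}$, with $m$ vertices labelled $+1$ and $n$ vertices labelled $-1$; independently for each pair of distinct vertices $i,j$, the edge $(i,j)$ is present with probability $p$ if $W_iW_j=1$ and with probability $q$ otherwise. Majority rule: given a graph $(V,E_t)$ and opinions $W^{(t)}_i\in\{\pm1\}$, set $W^{(t+1)}_i=\mathrm{sign}\big(\sum_{j:(i,j)\in E_t}W^{(t)}_j\big)$ if this sum is nonzero, and $W^{(t+1)}_i=W^{(t)}_i$ otherwise, simultaneously for all $i$. Write $V^{(t)}_\pm=\{i:W^{(t)}_i=\pm1\}$. Markovian model: the vertex set is $V=\{1,\dots,2n+\Delta\}$; initially $|V^{(0)}_+|=n+\Delta$, $|V^{(0)}_-|=n$, and $G_0\sim\mathsf{SBM}(n+\Delta,n,p,q)$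 with communities $V_+^{(0)},V_-^{(0)}$. For each day $t\in\mathbb N$, the opinions $W^{(t)}$ are computed from $(G_{t-1},W^{(t-1)})$ by the majority rule, and then all pairs are resampled afresh (independently of the past given $W^{(t)}$): $G_t\sim \mathsf{SBM}(|V^{(t)}_+|,|V^{(t)}_-|,p,q)$ with communities $V^{(t)}_+,V^{(t)}_-$. Opinion $+$ wins at day $t$ on the event $\mathscr P_t=\{|V^{(t)}_+|=2n+\Delta\}$; opinion $+$ wins eventually on $\mathscr P=\bigcup_{t\in\mathbb N}\mathscr P_t$. *)

theory Defs
  imports "HOL-Probability.Probability"
begin

text \<open>
  Graphs on the vertex set \<open>{1..N}\<close> are represented by their edge sets, an edge being a
  two-element set of vertices. Opinions (labels) are functions \<open>nat \<Rightarrow> int\<close>; only their values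
  on \<open>{1..N}\<close>, which lie in \<open>{-1, 1}\<close>, matter.
\<close>

type_synonym graph = "nat set set"

definition vertex_pairs :: "nat \<Rightarrow> nat set set" where
  "vertex_pairs N = {e. e \<subseteq> {1..N} \<and> card e = 2}"

text \<open>
  The stochastic block model, parametrised by the labelling \<open>W\<close> itself rather than only by the
  two community sizes. For \<open>e = {i, j}\<close> with \<open>i \<noteq> j\<close> the product below is \<open>W i * W j\<close>.
\<close>

definition SBM :: "real \<Rightarrow> real \<Rightarrow> nat \<Rightarrow> (nat \<Rightarrow> int) \<Rightarrow> graph pmf" where
  "SBM p q N W =
     map_pmf (\<lambda>present. {e \<in> vertex_pairs N. present e})
       (Pi_pmf (vertex_pairs N) False
          (\<lambda>e. bernoulli_pmf (if (\<Prod>i\<in>e. W i) = 1 then p else q)))"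

definition majority :: "nat \<Rightarrow> graph \<Rightarrow> (nat \<Rightarrow> int) \<Rightarrow> nat \<Rightarrow> int" where
  "majority N E W i =
     (let s = (\<Sum>j | j \<in> {1..N} \<and> {i, j} \<in> E. W j) in if s \<noteq> 0 then sgn s else W i)"

text \<open>
  A trajectory \<open>\<omega>\<close> lists the graphs \<open>G\<^sub>0, G\<^sub>1, \<dots>\<close>; the opinions on day \<open>t\<close> are determined by the
  initial opinions \<open>W0\<close> and the graphs of the days before \<open>t\<close>.
\<close>

primrec opinions :: "nat \<Rightarrow> (nat \<Rightarrow> int) \<Rightarrow> (nat \<Rightarrow> graph) \<Rightarrow> nat \<Rightarrow> (nat \<Rightarrow> int)" where
  "opinions N W0 \<omega> 0 = W0"
| "opinions N W0 \<omega> (Suc t) = majority N (\<omega> t) (opinions N W0 \<omega> t)"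

definition V_plus :: "nat \<Rightarrow> (nat \<Rightarrow> int) \<Rightarrow> nat set" where
  "V_plus N W = {i \<in> {1..N}. W i = 1}"

definition V_minus :: "nat \<Rightarrow> (nat \<Rightarrow> int) \<Rightarrow> nat set" where
  "V_minus N W = {i \<in> {1..N}. W i = -1}"

definition initial_opinions :: "nat \<Rightarrow> nat \<Rightarrow> (nat \<Rightarrow> int) \<Rightarrow> bool" where
  "initial_opinions n \<Delta> W \<longleftrightarrow>
     (\<forall>i\<in>{1..2 * n + \<Delta>}. W i \<in> {-1, 1}) \<and>
     card (V_plus (2 * n + \<Delta>) W) = n + \<Delta> \<and> card (V_minus (2 * n + \<Delta>) W) = n"

text \<open>
  Conditional law of the day-\<open>t\<close> graph given the graphs of the days before \<open>t\<close>.
\<close>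

definition resample :: "real \<Rightarrow> real \<Rightarrow> nat \<Rightarrow> (nat \<Rightarrow> int) \<Rightarrow> nat \<Rightarrow> (nat \<Rightarrow> graph) \<Rightarrow> graph measure"
  where "resample p q N W0 t \<omega> = measure_pmf (SBM p q N (opinions N W0 \<omega> t))"

text \<open>
  The law of the whole trajectory, obtained from the kernels \<open>resample\<close> by the Ionescu-Tulcea
  construction; that the construction applies is shown in \<open>Ionescu_Tulcea_resample\<close>.
\<close>

definition markovian_model :: "real \<Rightarrow> real \<Rightarrow> nat \<Rightarrow> (nat \<Rightarrow> int) \<Rightarrow> (nat \<Rightarrow> graph) measure" where
  "markovian_model p q N W0 =
     projective_family.lim UNIV
       (Ionescu_Tulcea.CI (resample p q N W0) (\<lambda>_. count_space UNIV))
       (\<lambda>_. count_space UNIV)"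

definition plus_wins_at :: "nat \<Rightarrow> (nat \<Rightarrow> int) \<Rightarrow> nat \<Rightarrow> (nat \<Rightarrow> graph) set" where
  "plus_wins_at N W0 t = {\<omega>. card (V_plus N (opinions N W0 \<omega> t)) = N}"

definition plus_wins :: "nat \<Rightarrow> (nat \<Rightarrow> int) \<Rightarrow> (nat \<Rightarrow> graph) set" where
  "plus_wins N W0 = (\<Union>t\<in>{1..}. plus_wins_at N W0 t)"

lemma SBM_cong:
  assumes "\<And>i. i \<in> {1..N} \<Longrightarrow> W i = W' i"
  shows "SBM p q N W = SBM p q N W'"
proof -
  have "(\<Prod>i\<in>e. W i) = (\<Prod>i\<in>e. W' i)" if "e \<in> vertex_pairs N" for e
    using that assms by (intro prod.cong) (auto simp: vertex_pairs_def)
  moreover have "finite (vertex_pairs N)"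
    by (rule finite_subset[of _ "Pow {1..N}"]) (auto simp: vertex_pairs_def)
  ultimately show ?thesis
    unfolding SBM_def by (intro arg_cong2[where f = map_pmf] Pi_pmf_cong) auto
qed

lemma measurable_opinions:
  assumes "{..<t} \<subseteq> I"
  shows "(\<lambda>\<omega>. opinions N W0 \<omega> t i) \<in> PiM I (\<lambda>_. count_space UNIV) \<rightarrow>\<^sub>M count_space UNIV"
  using assms
proof (induction t arbitrary: i)
  case 0
  show ?case by simp
next
  case (Suc t)
  let ?P = "PiM I (\<lambda>_. count_space UNIV :: graph measure)"
  have IH [measurable]: "(\<lambda>\<omega>. opinions N W0 \<omega> t j) \<in> ?P \<rightarrow>\<^sub>M count_space UNIV" for j
    using Suc.prems by (intro Suc.IH) (auto simp: lessThan_Suc)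
  have "t \<in> I"
    using Suc.prems by auto
  then have [measurable]: "(\<lambda>\<omega>. \<omega> t) \<in> ?P \<rightarrow>\<^sub>M count_space UNIV"
    by (rule measurable_component_singleton)
  have [measurable]: "(\<lambda>\<omega>. {i, j} \<in> \<omega> t) \<in> ?P \<rightarrow>\<^sub>M count_space UNIV" for j
    by (rule measurable_compose[where N = "count_space UNIV"]) simp_all
  have eq: "(\<Sum>j | j \<in> {1..N} \<and> {i, j} \<in> E. W j) = (\<Sum>j\<in>{1..N}. if {i, j} \<in> E then W j else 0)"
    for E and W :: "nat \<Rightarrow> int"
    by (subst sum.inter_filter[symmetric]) auto
  have [measurable]: "(\<lambda>\<omega>. \<Sum>j\<in>J. if {i, j} \<in> \<omega> t then opinions N W0 \<omega> t j else 0)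
      \<in> ?P \<rightarrow>\<^sub>M count_space UNIV" if "finite J" for J
    using that
  proof (induction J)
    case (insert j J)
    note insert.IH [measurable]
    show ?case
      using insert.hyps by simp
  qed simp
  show ?case
    unfolding opinions.simps majority_def Let_def eq by measurable
qed

lemma measurable_opinions_upto:
  assumes "{..<t} \<subseteq> I"
  shows "(\<lambda>\<omega>. map (opinions N W0 \<omega> t) xs) \<in> PiM I (\<lambda>_. count_space UNIV) \<rightarrow>\<^sub>M count_space UNIV"
proof (induction xs)
  case (Cons x xs)
  note Cons.IH [measurable] measurable_opinions[OF assms, measurable]
  show ?case by simp
qed simp

lemma Ionescu_Tulcea_resample:
  "Ionescu_Tulcea (resample p q N W0) (\<lambda>_. count_space UNIV)"
proof (rule Ionescu_Tulcea.intro)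
  fix t :: nat
  let ?dec = "\<lambda>xs i. xs ! (i - 1) :: int"
  have "SBM p q N (opinions N W0 \<omega> t) =
      SBM p q N (?dec (map (opinions N W0 \<omega> t) [1..<Suc N]))" for \<omega>
    by (rule SBM_cong) (auto simp del: upt_Suc)
  then have "resample p q N W0 t = 
      (\<lambda>xs. measure_pmf (SBM p q N (?dec xs))) \<circ> (\<lambda>\<omega>. map (opinions N W0 \<omega> t) [1..<Suc N])"
    by (simp add: resample_def fun_eq_iff del: upt_Suc)
  also have "\<dots> \<in> PiM {0..<t} (\<lambda>_. count_space UNIV) \<rightarrow>\<^sub>M subprob_algebra (count_space UNIV)"
    by (rule measurable_comp[OF measurable_opinions_upto])
       (auto simp: space_subprob_algebra intro: prob_space_imp_subprob_space
          measure_pmf.prob_space_axioms)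
  finally show "resample p q N W0 t \<in>
      PiM {0..<t} (\<lambda>_. count_space UNIV) \<rightarrow>\<^sub>M subprob_algebra (count_space UNIV)" .
qed (simp add: resample_def measure_pmf.prob_space_axioms)

lemma prob_space_markovian_model: "prob_space (markovian_model p q N W0)"
proof -
  interpret Ionescu_Tulcea "resample p q N W0" "\<lambda>_. count_space UNIV"
    by (rule Ionescu_Tulcea_resample)
  have "distr PF.lim (PiM {} (\<lambda>_. count_space UNIV)) (\<lambda>x. restrict x {}) = CI {}"
    by (rule distr_lim) simp
  then have "prob_space (distr PF.lim (PiM {} (\<lambda>_. count_space UNIV)) (\<lambda>x. restrict x {}))"
    using PF.prob_space_P by simp
  then show ?thesis
    unfolding markovian_model_def
    by (rule prob_space_distrD[rotated])
       (simp add: measurable_restrict_subset measurable_cong_sets[OF PF.sets_lim refl])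
qed

lemma sets_markovian_model:
  "sets (markovian_model p q N W0) = sets (PiM UNIV (\<lambda>_. count_space UNIV))"
proof -
  interpret Ionescu_Tulcea "resample p q N W0" "\<lambda>_. count_space UNIV"
    by (rule Ionescu_Tulcea_resample)
  show ?thesis
    unfolding markovian_model_def by simp
qed

lemma plus_wins_measurable: "plus_wins N W0 \<in> sets (markovian_model p q N W0)"
proof -
  have [simp]: "space (PiM UNIV (\<lambda>_. count_space UNIV)) = (UNIV :: (nat \<Rightarrow> graph) set)"
    by (auto simp: space_PiM)
  have "card (V_plus N W) = N \<longleftrightarrow> map W [1..<Suc N] \<in> {replicate N 1}" for W
  proof -
    have "card (V_plus N W) = N \<longleftrightarrow> V_plus N W = {1..N}"
    proof
      assume "card (V_plus N W) = N"
      then show "V_plus N W = {1..N}"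
        by (intro card_subset_eq) (auto simp: V_plus_def)
    qed simp
    also have "\<dots> \<longleftrightarrow> (\<forall>i\<in>{1..N}. W i = 1)"
      by (auto simp: V_plus_def)
    also have "\<dots> \<longleftrightarrow> map W [1..<Suc N] = replicate (length [1..<Suc N]) 1"
      by (subst map_replicate_const[symmetric])
         (auto simp: less_Suc_eq_le simp del: upt_Suc length_upt)
    finally show ?thesis
      by simp
  qed
  then have "plus_wins_at N W0 t =
      (\<lambda>\<omega>. map (opinions N W0 \<omega> t) [1..<Suc N]) -` {replicate N 1} \<inter>
        space (PiM UNIV (\<lambda>_. count_space UNIV))" for t
    by (auto simp: plus_wins_at_def simp del: upt_Suc)
  moreover have "(\<lambda>\<omega>. map (opinions N W0 \<omega> t) [1..<Suc N]) -` {replicate N 1} \<inter>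
        space (PiM UNIV (\<lambda>_. count_space UNIV)) \<in> sets (PiM UNIV (\<lambda>_. count_space UNIV))" for t
    by (rule measurable_sets[OF measurable_opinions_upto]) auto
  ultimately show ?thesis
    unfolding plus_wins_def sets_markovian_model by (intro sets.countable_UN') auto
qed

end

theory Submission
  imports Defs "HOL-Real_Asymp.Real_Asymp"
begin

text \<open>
  Since \<open>q < p\<close>, every vertex sees mostly its own opinion, and as long as neither
  camp is much larger than the other, a single vertex changes sides only with exponentially small
  probability. What decides the process is who changes sides first. Each vertex of the smaller
  camp is more likely to do so, by a factor that is exponential in the lead of the larger camp
  (\<open>flip_ratio\<close>); this rests on the log-concavity of the tails of a difference of
  binomial variables. Two vertices share only one edge, so simultaneous changes are of smaller
  order, and one day of the process is governed by three numbers: the probabilities that opinion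
  \<open>+\<close> gains without losing, that it loses somebody, and that it loses at least two
  vertices. If \<open>+\<close> leads and \<open>N\<close> is large, the second is at most a
  constant times the first, and a small fraction of it once the lead is large; the third is
  exponentially small compared with the first (\<open>rates\<close>).

  For part (ii), these rates make \<open>\<theta>\<close> to the power of the lead a
  supermartingale, for some \<open>\<theta> < 1\<close>, leads above a constant and large
  \<open>N\<close>. Hence \<open>-\<close> wins with exponentially small probability in the
  initial lead (\<open>Win_minority_small\<close>). As unanimity is reached almost surely
  (\<open>Win_complement\<close>), \<open>+\<close> wins otherwise.

  For part (i), let the advantage of a state be the probability that \<open>+\<close> wins minus
  the probability that \<open>-\<close> wins. It is harmonic and changes sign when the opinions
  are exchanged, and a coupling of all states by common coins shows that it increases with the
  number of vertices of opinion \<open>+\<close>. So a step back from a positive lead costs at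
  most twice the advantage itself, and since such steps are not much more frequent than steps
  forward, the advantage of a lead is at least a fixed fraction of that of the next one
  (\<open>advantage_step\<close>). Starting from a constant lead with advantage
  \<open>1/2\<close>, provided by the estimate for part (ii), finitely many such comparisons reach
  lead one with a constant that does not depend on \<open>N\<close>. In the finitely many small
  systems a strict majority has a positive advantage, because the complete graph makes it win at
  once (\<open>advantage_pos\<close>).
\<close>

locale homophily =
  fixes p q :: real
  assumes q_pos: "0 < q" and q_less_p: "q < p" and p_le_1: "p \<le> 1"
begin

lemma p_pos: "0 < p" and q_less_1: "q < 1"
  using q_pos q_less_p p_le_1 by linarith+

section \<open>Upper tails of a difference of two binomial variables\<close>

primrec opp_tail :: "nat \<Rightarrow> int \<Rightarrow> real" where
  "opp_tail 0 z = (if z \<le> 0 then 1 else 0)"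
| "opp_tail (Suc k) z = (1 - q) * opp_tail k z + q * opp_tail k (z - 1)"

text \<open>
  \<open>tail m k z\<close> is \<open>P(Y - X \<ge> z)\<close> for independent binomial variables \<open>X\<close> with parameters \<open>m, p\<close>
  and \<open>Y\<close> with parameters \<open>k, q\<close>. For a vertex with \<open>m\<close> potential neighbours of its own opinion
  and \<open>k\<close> of the other one, \<open>tail m k 1\<close> is the probability that it changes its opinion.
\<close>

primrec tail :: "nat \<Rightarrow> nat \<Rightarrow> int \<Rightarrow> real" where
  "tail 0 k z = opp_tail k z"
| "tail (Suc m) k z = (1 - p) * tail m k z + p * tail m k (z + 1)"

lemma tail_Suc_right: "tail m (Suc k) z = (1 - q) * tail m k z + q * tail m k (z - 1)"
proof (induction m arbitrary: z)
  case (Suc m)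
  have "tail m k (z + 1 - 1) = tail m k (z - 1 + 1)" by simp
  then show ?case
    by (simp only: tail.simps Suc.IH) (simp add: algebra_simps)
qed simp

lemma tail_induct [case_names base same opposite]:
  assumes "P 0 0" and "\<And>m k. P m k \<Longrightarrow> P (Suc m) k" and "\<And>m k. P m k \<Longrightarrow> P m (Suc k)"
  shows "P m k"
proof (induction m)
  case 0
  show ?case by (induction k) (use assms in auto)
qed (use assms in auto)

lemma tail_nonneg: "0 \<le> tail m k z"
  using q_pos q_less_1 p_pos p_le_1
  by (induction m k arbitrary: z rule: tail_induct) (auto simp: tail_Suc_right)

lemma tail_antimono: "z \<le> z' \<Longrightarrow> tail m k z' \<le> tail m k z"
proof (induction m k arbitrary: z z' rule: tail_induct)
  case (same m k)
  with p_pos p_le_1 show ?case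
    by (auto intro!: add_mono mult_left_mono)
next
  case (opposite m k)
  with q_pos q_less_1 show ?case
    by (auto simp: tail_Suc_right intro!: add_mono mult_left_mono)
qed auto

lemma tail_eq_1: "z \<le> - int m \<Longrightarrow> tail m k z = 1"
  by (induction m k arbitrary: z rule: tail_induct) (auto simp: tail_Suc_right)

lemma tail_antimono_same: "m \<le> m' \<Longrightarrow> tail m' k z \<le> tail m k z"
proof (induction rule: dec_induct)
  case (step n)
  have "tail (Suc n) k z \<le> (1 - p) * tail n k z + p * tail n k z"
    using p_pos p_le_1 by (auto intro!: mult_left_mono tail_antimono)
  with step show ?case by (simp add: algebra_simps)
qed simp

lemma tail_mono_opposite: "k \<le> k' \<Longrightarrow> tail m k z \<le> tail m k' z"
proof (induction rule: dec_induct)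
  case (step n)
  have "(1 - q) * tail m n z + q * tail m n z \<le> tail m (Suc n) z"
    unfolding tail_Suc_right using q_pos q_less_1 by (auto intro!: mult_left_mono tail_antimono)
  with step show ?case by (simp add: algebra_simps)
qed simp

lemma tail_pos: "z \<le> int k - int m \<Longrightarrow> 0 < tail m k z"
proof (induction m k arbitrary: z rule: tail_induct)
  case (same m k)
  have "0 < tail m k (z + 1)" using same by simp
  with p_pos p_le_1 tail_nonneg[of m k z] show ?case
    by (auto intro!: add_nonneg_pos)
next
  case (opposite m k)
  have "0 < tail m k (z - 1)" using opposite by simp
  with q_pos q_less_1 tail_nonneg[of m k z] show ?case
    by (auto simp: tail_Suc_right intro!: add_nonneg_pos)
qed auto

text \<open>
  Log-concavity of the tails. The form with two free indices is the one that is stable under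
  mixing with a shift: expanding the product gives two instances of the hypothesis and a mixed
  term, which needs the hypothesis for indices further apart.
\<close>

definition log_concave :: "(int \<Rightarrow> real) \<Rightarrow> bool" where
  "log_concave f \<longleftrightarrow> (\<forall>i j. i \<le> j \<longrightarrow> f (i - 1) * f (j + 1) \<le> f i * f j)"

lemma log_concave_mix:
  assumes f: "log_concave f" and a: "0 \<le> a" and b: "0 \<le> b"
  shows "log_concave (\<lambda>z. a * f z + b * f (z - 1))"
  unfolding log_concave_def
proof (intro allI impI)
  fix i j :: int
  assume ij: "i \<le> j"
  have lc: "f (u - 1) * f (v + 1) \<le> f u * f v" if "u \<le> v" for u v
    using f that by (auto simp: log_concave_def)
  have 1: "f (i - 1) * f (j + 1) \<le> f i * f j"
    using lc[OF ij] .
  have 2: "f (i - 2) * f j \<le> f (i - 1) * f (j - 1)"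
    using lc[of "i - 1" "j - 1"] ij by simp
  have 3: "f (i - 2) * f (j + 1) \<le> f i * f (j - 1)"
  proof (cases "i = j")
    case True
    then show ?thesis using lc[of "i - 1" j] by (simp add: mult.commute)
  next
    case False
    then have "f (i - 2) * f (j + 1) \<le> f (i - 1) * f j" "f (i - 1) * f j \<le> f i * f (j - 1)"
      using lc[of "i - 1" j] lc[of i "j - 1"] ij by simp_all
    then show ?thesis by linarith
  qed
  have "a\<^sup>2 * (f (i - 1) * f (j + 1)) + b\<^sup>2 * (f (i - 2) * f j) + a * b * (f (i - 2) * f (j + 1))
      \<le> a\<^sup>2 * (f i * f j) + b\<^sup>2 * (f (i - 1) * f (j - 1)) + a * b * (f i * f (j - 1))"
    using 1 2 3 a b by (intro add_mono mult_left_mono) auto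
  then show "(a * f (i - 1) + b * f (i - 1 - 1)) * (a * f (j + 1) + b * f (j + 1 - 1))
      \<le> (a * f i + b * f (i - 1)) * (a * f j + b * f (j - 1))"
    by (simp add: algebra_simps power2_eq_square)
qed

lemma log_concave_shift: "log_concave f \<Longrightarrow> log_concave (\<lambda>z. f (z + c))"
  unfolding log_concave_def
proof (intro allI impI)
  fix i j :: int
  assume "\<forall>i j. i \<le> j \<longrightarrow> f (i - 1) * f (j + 1) \<le> f i * f j" "i \<le> j"
  then have "f (i + c - 1) * f (j + c + 1) \<le> f (i + c) * f (j + c)" by auto
  then show "f (i - 1 + c) * f (j + 1 + c) \<le> f (i + c) * f (j + c)"
    by (simp add: algebra_simps)
qed

lemma log_concave_tail: "log_concave (tail m k)"
proof (induction m k rule: tail_induct)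
  case base
  show ?case by (auto simp: log_concave_def)
next
  case (same m k)
  have "log_concave (\<lambda>z. p * tail m k (z + 1) + (1 - p) * tail m k (z - 1 + 1))"
    using p_pos p_le_1 by (intro log_concave_mix[OF log_concave_shift[OF same]]) auto
  also have "(\<lambda>z. p * tail m k (z + 1) + (1 - p) * tail m k (z - 1 + 1)) = tail (Suc m) k"
    by (auto simp: fun_eq_iff)
  finally show ?case .
next
  case (opposite m k)
  have "log_concave (\<lambda>z. (1 - q) * tail m k z + q * tail m k (z - 1))"
    using q_pos q_less_1 by (intro log_concave_mix opposite) auto
  also have "(\<lambda>z. (1 - q) * tail m k z + q * tail m k (z - 1)) = tail m (Suc k)"
    by (auto simp: fun_eq_iff tail_Suc_right)
  finally show ?case .
qed

lemma tail_mgf: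
  assumes "0 \<le> s"
  shows "tail m k z \<le> exp (- s * z) * (1 + q * (exp s - 1)) ^ k * (1 + p * (exp (-s) - 1)) ^ m"
proof (induction m k arbitrary: z rule: tail_induct)
  case base
  have "1 \<le> exp (- (s * real_of_int z))" if "z \<le> 0"
    using assms that by (simp add: mult_nonneg_nonpos)
  then show ?case by auto
next
  case (same m k)
  let ?R = "(1 + q * (exp s - 1)) ^ k * (1 + p * (exp (-s) - 1)) ^ m"
  have "tail (Suc m) k z
      \<le> (1 - p) * (exp (- s * z) * ?R) + p * (exp (- s * (z + 1)) * ?R)"
    using p_pos p_le_1 same[of z] same[of "z + 1"]
    by (auto intro!: add_mono mult_left_mono simp: mult.assoc)
  also have "exp (- s * real_of_int (z + 1)) = exp (- s * z) * exp (- s)"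
    by (simp add: algebra_simps flip: exp_add)
  finally show ?case by (simp add: algebra_simps)
next
  case (opposite m k)
  let ?R = "(1 + q * (exp s - 1)) ^ k * (1 + p * (exp (-s) - 1)) ^ m"
  have "tail m (Suc k) z
      \<le> (1 - q) * (exp (- s * z) * ?R) + q * (exp (- s * (z - 1)) * ?R)"
    using q_pos q_less_1 opposite[of z] opposite[of "z - 1"]
    by (auto simp: tail_Suc_right mult.assoc intro!: add_mono mult_left_mono)
  also have "exp (- s * real_of_int (z - 1)) = exp (- s * z) * exp s"
    by (simp add: algebra_simps flip: exp_add)
  finally show ?case by (simp add: algebra_simps)
qed

text \<open>
  Chernoff's bound; the quadratic term absorbs the error in \<open>exp s \<approx> 1 + s\<close>.
\<close>

lemma tail_chernoff:
  assumes s: "0 \<le> s" "s \<le> 1"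
  shows "tail m k z \<le> exp (- s * z + s * (k * q - m * p) + s\<^sup>2 * (k + m))"
proof -
  have e1: "exp s - 1 \<le> s + s\<^sup>2"
    using exp_bound[of s] s by simp
  have e2: "exp (-s) - 1 \<le> - s + s\<^sup>2"
  proof -
    have "exp (-s) = 1 / exp s" by (simp add: exp_minus divide_inverse)
    also have "\<dots> \<le> 1 / (1 + s)"
      using s exp_ge_add_one_self[of s] by (intro divide_left_mono) auto
    also have "\<dots> \<le> 1 - s + s\<^sup>2"
      using s by (simp add: field_simps power2_eq_square)
    finally show ?thesis by simp
  qed
  have f1: "1 + q * (exp s - 1) \<le> exp (s * q + s\<^sup>2)"
  proof -
    have "q * (exp s - 1) \<le> q * s + q * s\<^sup>2"
      using mult_left_mono[OF e1, of q] q_pos by (simp add: algebra_simps)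
    also have "\<dots> \<le> s * q + s\<^sup>2"
      using mult_right_mono[of q 1 "s\<^sup>2"] q_less_1 by simp
    finally show ?thesis using exp_ge_add_one_self[of "s * q + s\<^sup>2"] by linarith
  qed
  have f2: "1 + p * (exp (-s) - 1) \<le> exp (- (s * p) + s\<^sup>2)"
  proof -
    have "p * (exp (-s) - 1) \<le> - (p * s) + p * s\<^sup>2"
      using mult_left_mono[OF e2, of p] p_pos by (simp add: algebra_simps)
    also have "\<dots> \<le> - (s * p) + s\<^sup>2"
      using mult_right_mono[of p 1 "s\<^sup>2"] p_le_1 by simp
    finally show ?thesis using exp_ge_add_one_self[of "- (s * p) + s\<^sup>2"] by linarith
  qed
  have g1: "0 \<le> 1 + q * (exp s - 1)"
    using s q_pos by (intro add_nonneg_nonneg mult_nonneg_nonneg) auto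
  have g2: "0 \<le> 1 + p * (exp (-s) - 1)"
  proof -
    have "p * (1 - exp (-s)) \<le> 1 * 1"
      using s p_pos p_le_1 by (intro mult_mono) auto
    then show ?thesis by (simp add: algebra_simps)
  qed
  have "tail m k z \<le> exp (- s * z) * (1 + q * (exp s - 1)) ^ k * (1 + p * (exp (-s) - 1)) ^ m"
    by (rule tail_mgf[OF s(1)])
  also have "\<dots> \<le> exp (- s * z) * exp (s * q + s\<^sup>2) ^ k * exp (- (s * p) + s\<^sup>2) ^ m"
    using f1 f2 g1 g2 by (intro mult_mono power_mono) auto
  also have "\<dots> = exp (- s * z + s * (k * q - m * p) + s\<^sup>2 * (k + m))"
    by (simp add: algebra_simps flip: exp_of_nat_mult exp_add)
  finally show ?thesis by simp
qed

text \<open>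
  Consecutive ratios of a log-concave tail decrease, so if the last one were close to \<open>1\<close>, all
  earlier ones would be, and the tail could not have dropped from \<open>1\<close> to a tiny value.
\<close>

lemma tail_ratio:
  assumes "tail m k 1 < r ^ Suc m" and "0 \<le> r"
  shows "tail m k 2 \<le> r * tail m k 1"
proof (rule ccontr)
  assume "\<not> ?thesis"
  then have gt: "r * tail m k 1 < tail m k 2" by simp
  have pos: "0 < tail m k 1"
    using gt tail_antimono[of 1 2 m k] tail_nonneg[of m k 1] by (cases "tail m k 1 = 0") auto
  have step: "r * tail m k (i - 1) \<le> tail m k i" if "i \<le> 1" for i
  proof -
    have "tail m k (i - 1) * (r * tail m k 1) \<le> tail m k (i - 1) * tail m k 2"
      using gt by (intro mult_left_mono tail_nonneg) simp
    also have "\<dots> \<le> tail m k i * tail m k 1"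
      using log_concave_tail[of m k, unfolded log_concave_def, rule_format, OF that] by simp
    finally have "(r * tail m k (i - 1)) * tail m k 1 \<le> tail m k i * tail m k 1"
      by (simp add: algebra_simps)
    with pos show ?thesis by (simp add: mult_le_cancel_right)
  qed
  have "r ^ j \<le> tail m k (int j - int m)" if "j \<le> Suc m" for j
    using that
  proof (induction j)
    case 0
    show ?case by (simp add: tail_eq_1)
  next
    case (Suc j)
    then have "r ^ Suc j \<le> r * tail m k (int j - int m)"
      using \<open>0 \<le> r\<close> by (auto intro: mult_left_mono)
    also have "\<dots> \<le> tail m k (int (Suc j) - int m)"
      using step[of "int (Suc j) - int m"] Suc.prems by (simp add: algebra_simps)
    finally show ?case .
  qed
  from this[of "Suc m"] assms show False by simp
qed

text \<open>
  A chance of changing sides that is already exponentially small shrinks by a constant factor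
  with each further neighbour of the same opinion.
\<close>

lemma tail_decay:
  obtains r where "0 < r" "r < 1"
    "\<And>m k. k \<le> Suc m \<Longrightarrow> 3 \<le> m \<Longrightarrow> tail (Suc m) k 1 \<le> r * tail m k 1"
proof
  \<comment> \<open>For \<open>k \<approx> m\<close> the Chernoff exponent is about \<open>- s m (p - q) + 2 m s\<^sup>2\<close>, which is smallest here.\<close>
  define s where "s = (p - q) / 4"
  have s: "0 < s" "s \<le> 1" "p - q = 4 * s"
    using q_less_p q_pos p_le_1 by (auto simp: s_def)
  define r where "r = exp (- s\<^sup>2)"
  have r: "0 < r" "r < 1" using s by (auto simp: r_def)
  have pr: "0 < p * (1 - r)" "p * (1 - r) \<le> p"
    using p_pos r by (auto simp: mult_le_cancel_left1)
  show "1 - p * (1 - r) < 1" using pr by simp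
  show "0 < 1 - p * (1 - r)"
    using mult_strict_left_mono[of "1 - r" 1 p] p_pos p_le_1 r by linarith
  fix m k :: nat
  assume k: "k \<le> Suc m" and m: "3 \<le> m"
  have "k * q - m * p \<le> (1 + m) * q - m * p"
    using k q_pos mult_right_mono[of "real k" "1 + real m" q] by simp
  also have "\<dots> = q - m * (4 * s)" unfolding s(3)[symmetric] by (simp add: algebra_simps)
  finally have "s * (k * q - m * p) \<le> s * (q - m * (4 * s))"
    using s by (intro mult_left_mono) auto
  moreover have "s * q \<le> s" using s q_less_1 by simp
  moreover have "s\<^sup>2 * (real k + real m) \<le> s\<^sup>2 * (2 * real m + 1)"
    using k by (intro mult_left_mono) auto
  moreover have "s\<^sup>2 * 3 \<le> s\<^sup>2 * real m"
    using m by (intro mult_left_mono) auto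
  moreover have "0 < s\<^sup>2" using s by simp
  ultimately have "- s * real_of_int 1 + s * (k * q - m * p) + s\<^sup>2 * (real k + real m) < Suc m * (- s\<^sup>2)"
    by (simp add: algebra_simps power2_eq_square)
  then have "exp (- s * real_of_int 1 + s * (k * q - m * p) + s\<^sup>2 * (real k + real m)) < r ^ Suc m"
    unfolding r_def by (subst exp_of_nat_mult[symmetric]) simp
  with tail_chernoff[of s m k 1] s have "tail m k 1 < r ^ Suc m" by simp
  then have "tail m k 2 \<le> r * tail m k 1"
    using r by (intro tail_ratio) auto
  then have "p * tail m k 2 \<le> p * (r * tail m k 1)"
    using p_pos by (intro mult_left_mono) auto
  then show "tail (Suc m) k 1 \<le> (1 - p * (1 - r)) * tail m k 1"
    by (simp add: algebra_simps)
qed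

text \<open>
  Here \<open>a\<close> and \<open>b\<close> are the sizes of the majority and of the minority. Against the same \<open>b\<close>
  opponents, each of the \<open>a - b\<close> additional vertices of its own opinion costs a majority vertex
  a constant factor, except for the first few, where the tail need not be small yet; and more
  opponents only make a change of a minority vertex more likely.
\<close>

lemma flip_ratio:
  obtains r where "0 < r" "r < 1"
    "\<And>a b. 1 \<le> b \<Longrightarrow> b \<le> a \<Longrightarrow> tail (a - 1) b 1 \<le> r ^ (a - b - 3) * tail (b - 1) a 1"
proof -
  obtain r where r: "0 < r" "r < 1"
    and decay: "\<And>m k. k \<le> Suc m \<Longrightarrow> 3 \<le> m \<Longrightarrow> tail (Suc m) k 1 \<le> r * tail m k 1"
    using tail_decay by blast
  have "tail (a - 1) b 1 \<le> r ^ (a - b - 3) * tail (b - 1) a 1" if ab: "1 \<le> b" "b \<le> a" for a b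
  proof -
    have "tail (b - 1 + j) b 1 \<le> r ^ (j - 3) * tail (b - 1) b 1" for j
    proof (induction j)
      case (Suc j)
      show ?case
      proof (cases "3 \<le> j")
        case True
        have "tail (Suc (b - 1 + j)) b 1 \<le> r * tail (b - 1 + j) b 1"
          using True by (intro decay) auto
        also have "\<dots> \<le> r * (r ^ (j - 3) * tail (b - 1) b 1)"
          using r Suc by (intro mult_left_mono) auto
        also have "\<dots> = r ^ (Suc j - 3) * tail (b - 1) b 1"
        proof -
          have "Suc j - 3 = Suc (j - 3)" using True by simp
          then show ?thesis by (simp only: power_Suc mult.assoc)
        qed
        finally show ?thesis by simp
      next
        case False
        then show ?thesis using tail_antimono_same[of "b - 1" "b - 1 + Suc j" b 1] by simp
      qed
    qed simp
    from this[of "a - b"] have "tail (a - 1) b 1 \<le> r ^ (a - b - 3) * tail (b - 1) b 1"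
      using ab by simp
    also have "\<dots> \<le> r ^ (a - b - 3) * tail (b - 1) a 1"
      using r ab by (intro mult_left_mono tail_mono_opposite) auto
    finally show ?thesis .
  qed
  with r that show thesis by blast
qed

definition conc_rate :: real where
  "conc_rate = (p - q)\<^sup>2 / 144"

lemma conc_rate_pos: "0 < conc_rate"
  using q_less_p by (simp add: conc_rate_def)

text \<open>
  The argument is \<open>-1\<close> rather than \<open>1\<close> because these bounds are used after the status of one edge
  has been disregarded, which shifts the difference by at most one on either side.
\<close>

lemma tail_majority_small:
  assumes "1 \<le> b" "b \<le> a"
  shows "tail (a - 1) b (-1) \<le> exp (2 - conc_rate * (real a + real b))"
proof -
  define s where "s = (p - q) / 12"
  have s: "0 < s" "s \<le> 1" "p - q = 12 * s" "conc_rate = s\<^sup>2"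
    using q_less_p q_pos p_le_1 by (auto simp: s_def conc_rate_def power2_eq_square)
  have a: "real (a - 1) = real a - 1" using assms by (simp add: of_nat_diff)
  have "0 \<le> (real a - real b) * (p + q)" using assms p_pos q_pos by simp
  then have "b * q - real (a - 1) * p \<le> p - (p - q) * (real a + real b) / 2"
    unfolding a by (simp add: field_simps)
  also have "\<dots> \<le> 1 - 6 * s * (real a + real b)"
    using p_le_1 s by simp
  finally have "s * (b * q - real (a - 1) * p) \<le> s * (1 - 6 * s * (real a + real b))"
    using s by (intro mult_left_mono) auto
  also have "\<dots> = s - 6 * s\<^sup>2 * (real a + real b)" by (simp add: algebra_simps power2_eq_square)
  finally have "s * (b * q - real (a - 1) * p) \<le> s - 6 * (s\<^sup>2 * (real a + real b))" by simp
  moreover have "s\<^sup>2 * (b + real (a - 1)) \<le> s\<^sup>2 * (real a + real b)"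
    unfolding a by (intro mult_left_mono) auto
  moreover have "0 \<le> s\<^sup>2 * (real a + real b)" by simp
  ultimately have "s + s * (b * q - real (a - 1) * p) + s\<^sup>2 * (b + real (a - 1))
      \<le> 2 - conc_rate * (real a + real b)"
    unfolding s(4) using s(2) by linarith
  then show ?thesis
    using s by (intro order_trans[OF tail_chernoff[of s]]) auto
qed

text \<open>
  A minority vertex is stable as long as the surplus \<open>a - b\<close> of opposite neighbours, which counts
  with weight \<open>q\<close>, leaves half of the drift \<open>b * (p - q)\<close> towards its own opinion.
\<close>

lemma tail_minority_small:
  assumes "1 \<le> b" "b \<le> a" and lead: "real a - real b \<le> b * (p - q) / 2"
  shows "tail (b - 1) a (-1) \<le> exp (2 - conc_rate * (real a + real b))"
proof -
  define s where "s = (p - q) / 12"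
  have s: "0 < s" "s \<le> 1" "p - q = 12 * s" "conc_rate = s\<^sup>2"
    using q_less_p q_pos p_le_1 by (auto simp: s_def conc_rate_def power2_eq_square)
  have b: "real (b - 1) = real b - 1" using assms by (simp add: of_nat_diff)
  have "(real a - real b) * q \<le> (b * (p - q) / 2) * 1"
    using lead assms q_pos q_less_1 by (intro mult_mono) auto
  then have "a * q - real (b - 1) * p \<le> p - (p - q) * real b / 2"
    unfolding b by (simp add: field_simps)
  also have "\<dots> \<le> 1 - 6 * s * real b"
    using p_le_1 s by simp
  finally have "s * (a * q - real (b - 1) * p) \<le> s * (1 - 6 * s * real b)"
    using s by (intro mult_left_mono) auto
  also have "\<dots> = s - 6 * s\<^sup>2 * real b" by (simp add: algebra_simps power2_eq_square)
  finally have "s * (a * q - real (b - 1) * p) \<le> s - 6 * (s\<^sup>2 * real b)" by simp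
  moreover have ab: "real a + real b \<le> 3 * real b"
    using lead mult_left_mono[of "p - q" 1 "real b"] p_le_1 q_pos by simp
  moreover have "s\<^sup>2 * (real a + real (b - 1)) \<le> s\<^sup>2 * (3 * real b)"
    "s\<^sup>2 * (real a + real b) \<le> s\<^sup>2 * (3 * real b)"
    using ab unfolding b by (intro mult_left_mono; simp)+
  ultimately have "s + s * (a * q - real (b - 1) * p) + s\<^sup>2 * (a + real (b - 1))
      \<le> 2 - conc_rate * (real a + real b)"
    unfolding s(4) using s(2) by linarith
  then show ?thesis
    using s by (intro order_trans[OF tail_chernoff[of s]]) auto
qed

end

section \<open>Product distributions\<close>

lemma Pi_pmf_depend_cong:
  assumes "finite A" "B \<subseteq> A"
    and "\<And>f g. (\<And>x. x \<in> B \<Longrightarrow> f x = g x) \<Longrightarrow> P f \<longleftrightarrow> P g"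
  shows "measure_pmf.prob (Pi_pmf A d w) {f. P f} = measure_pmf.prob (Pi_pmf B d w) {f. P f}"
proof -
  have "P (\<lambda>x. if x \<in> B then f x else d) \<longleftrightarrow> P f" for f
    by (rule assms(3)) simp
  then show ?thesis
    by (simp add: Pi_pmf_subset[OF assms(1,2)] vimage_def)
qed

lemma measure_pmf_prob_pair:
  "measure_pmf.prob (pair_pmf M N) (A \<times> B) = measure_pmf.prob M A * measure_pmf.prob N B"
proof -
  have "measure_pmf.prob (pair_pmf M N) (A \<times> B) =
      measure_pmf.prob (pair_pmf M N) ((A \<inter> set_pmf M) \<times> (B \<inter> set_pmf N))"
    by (subst measure_Int_set_pmf[symmetric]) (simp add: Times_Int_Times)
  then show ?thesis
    by (simp add: measure_pmf_prob_product countable_Int2 measure_Int_set_pmf)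
qed

text \<open>Restricted to \<open>B \<union> C\<close>, the product is a pair of products, one for each of the events.\<close>

lemma Pi_pmf_indep:
  assumes A: "finite A" and B: "B \<subseteq> A" and C: "C \<subseteq> A" and disj: "B \<inter> C = {}"
    and P: "\<And>f g. (\<And>x. x \<in> B \<Longrightarrow> f x = g x) \<Longrightarrow> P f \<longleftrightarrow> P g"
    and Q: "\<And>f g. (\<And>x. x \<in> C \<Longrightarrow> f x = g x) \<Longrightarrow> Q f \<longleftrightarrow> Q g"
  shows "measure_pmf.prob (Pi_pmf A d w) {f. P f \<and> Q f} =
    measure_pmf.prob (Pi_pmf A d w) {f. P f} * measure_pmf.prob (Pi_pmf A d w) {f. Q f}"
proof -
  have fin: "finite B" "finite C" using A B C by (auto intro: finite_subset)
  have P': "P (\<lambda>x. if x \<in> B then f x else g x) \<longleftrightarrow> P f" for f g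
    by (rule P) simp
  have Q': "Q (\<lambda>x. if x \<in> B then f x else g x) \<longleftrightarrow> Q g" for f g
    using disj by (intro Q) auto
  have "measure_pmf.prob (Pi_pmf A d w) {f. P f \<and> Q f} =
      measure_pmf.prob (Pi_pmf (B \<union> C) d w) {f. P f \<and> Q f}"
  proof (rule Pi_pmf_depend_cong[OF A])
    fix f g :: "'a \<Rightarrow> 'b"
    assume "\<And>x. x \<in> B \<union> C \<Longrightarrow> f x = g x"
    then show "(P f \<and> Q f) \<longleftrightarrow> (P g \<and> Q g)" using P[of f g] Q[of f g] by auto
  qed (use B C in auto)
  also have "\<dots> = measure_pmf.prob (pair_pmf (Pi_pmf B d w) (Pi_pmf C d w)) ({f. P f} \<times> {f. Q f})"
    unfolding Pi_pmf_union[OF fin disj]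
    by (auto simp: vimage_def case_prod_beta P' Q' intro!: arg_cong2[where f = measure_pmf.prob])
  also have "\<dots> = measure_pmf.prob (Pi_pmf B d w) {f. P f} * measure_pmf.prob (Pi_pmf C d w) {f. Q f}"
    by (simp add: measure_pmf_prob_pair)
  finally show ?thesis
    by (simp add: Pi_pmf_depend_cong[OF A B P] Pi_pmf_depend_cong[OF A C Q])
qed

lemma Pi_pmf_map_dep:
  assumes "finite A"
  shows "Pi_pmf A d (\<lambda>x. map_pmf (f x) (w x)) =
    map_pmf (\<lambda>h x. if x \<in> A then f x (h x) else d) (Pi_pmf A d' w)"
proof -
  have "Pi_pmf A d (\<lambda>x. map_pmf (f x) (w x)) =
      Pi_pmf A d (\<lambda>x. bind_pmf (w x) (\<lambda>y. return_pmf (f x y)))"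
    by (simp add: map_pmf_def)
  also have "\<dots> = bind_pmf (Pi_pmf A d' w) (\<lambda>h. Pi_pmf A d (\<lambda>x. return_pmf (f x (h x))))"
    by (rule Pi_pmf_bind[OF assms])
  finally show ?thesis
    by (simp add: assms map_pmf_def)
qed

section \<open>One day of the process\<close>

text \<open>
  Only the set \<open>A\<close> of vertices of opinion \<open>+\<close> matters for the dynamics, so it serves as the
  state; \<open>label A\<close> recovers the opinions, and a graph is given by the predicate \<open>x\<close> of the
  pairs that are present.
\<close>

definition label :: "nat set \<Rightarrow> nat \<Rightarrow> int" where
  "label A i = (if i \<in> A then 1 else -1)"

definition field :: "nat \<Rightarrow> (nat set \<Rightarrow> bool) \<Rightarrow> nat set \<Rightarrow> nat \<Rightarrow> int" where
  "field N x A i = (\<Sum>j\<in>{1..N} - {i}. if x {i, j} then label A j else 0)"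

definition next_plus :: "nat \<Rightarrow> (nat set \<Rightarrow> bool) \<Rightarrow> nat set \<Rightarrow> nat set" where
  "next_plus N x A = {i \<in> {1..N}. 0 < field N x A i \<or> (field N x A i = 0 \<and> i \<in> A)}"

text \<open>
  The field seen from the vertex itself: positive if the majority of its neighbours disagrees
  with it.
\<close>

definition pressure :: "nat \<Rightarrow> (nat set \<Rightarrow> bool) \<Rightarrow> nat set \<Rightarrow> nat \<Rightarrow> int" where
  "pressure N x A i = - label A i * field N x A i"

definition flips :: "nat \<Rightarrow> (nat set \<Rightarrow> bool) \<Rightarrow> nat set \<Rightarrow> nat set" where
  "flips N x A = {i \<in> {1..N}. 1 \<le> pressure N x A i}"

definition same_side :: "nat set \<Rightarrow> nat set \<Rightarrow> bool" where
  "same_side A e \<longleftrightarrow> (\<Prod>i\<in>e. label A i) = 1"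

lemma same_side_pair: "i \<noteq> j \<Longrightarrow> same_side A {i, j} \<longleftrightarrow> (i \<in> A \<longleftrightarrow> j \<in> A)"
  by (auto simp: same_side_def label_def)

lemma finite_vertex_pairs [simp, intro]: "finite (vertex_pairs N)"
  by (rule finite_subset[of _ "Pow {1..N}"]) (auto simp: vertex_pairs_def)

lemma pair_in_vertex_pairs: "{i, j} \<in> vertex_pairs N \<longleftrightarrow> i \<in> {1..N} \<and> j \<in> {1..N} \<and> i \<noteq> j"
  by (auto simp: vertex_pairs_def card_insert_if)

lemma next_plus_subset: "next_plus N x A \<subseteq> {1..N}"
  by (auto simp: next_plus_def)

lemma next_plus_eq_flips:
  assumes "A \<subseteq> {1..N}"
  shows "next_plus N x A = (A - flips N x A) \<union> (flips N x A - A)"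
  using assms by (auto simp: next_plus_def flips_def pressure_def label_def)

lemma card_next_plus:
  assumes A: "A \<subseteq> {1..N}"
  shows "card (next_plus N x A) + card (A \<inter> flips N x A) = card A + card (flips N x A - A)"
proof -
  have fin: "finite A" "finite (flips N x A)" using A by (auto intro: finite_subset simp: flips_def)
  have "card (next_plus N x A) = card (A - flips N x A) + card (flips N x A - A)"
    unfolding next_plus_eq_flips[OF A] using fin by (intro card_Un_disjoint) auto
  then show ?thesis
    using card_Int_Diff[OF fin(1), of "flips N x A"] by linarith
qed

lemma majority_eq_next_plus:
  assumes W: "\<And>i. i \<in> {1..N} \<Longrightarrow> W i \<in> {-1, 1}" and i: "i \<in> {1..N}"
  shows "majority N {e \<in> vertex_pairs N. x e} W i = label (next_plus N x (V_plus N W)) i"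
proof -
  have lab: "W j = label (V_plus N W) j" if "j \<in> {1..N}" for j
    using W[OF that] that by (auto simp: label_def V_plus_def)
  have "{j. j \<in> {1..N} \<and> {i, j} \<in> {e \<in> vertex_pairs N. x e}} = {j \<in> {1..N} - {i}. x {i, j}}"
    using i by (auto simp: pair_in_vertex_pairs)
  moreover have "(\<Sum>j\<in>{j \<in> {1..N} - {i}. x {i, j}}. W j) =
      (\<Sum>j\<in>{j \<in> {1..N} - {i}. x {i, j}}. label (V_plus N W) j)"
    by (rule sum.cong[OF refl], rule lab) simp
  moreover have "\<dots> = field N x (V_plus N W) i"
    unfolding field_def by (subst sum.inter_filter) auto
  ultimately have "majority N {e \<in> vertex_pairs N. x e} W i =
      (if field N x (V_plus N W) i \<noteq> 0 then sgn (field N x (V_plus N W) i) else W i)"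
    by (simp add: majority_def Let_def)
  then show ?thesis
    using i lab[OF i] by (auto simp: label_def next_plus_def sgn_if)
qed

lemma V_plus_majority:
  assumes "\<And>i. i \<in> {1..N} \<Longrightarrow> W i \<in> {-1, 1}"
  shows "V_plus N (majority N {e \<in> vertex_pairs N. x e} W) = next_plus N x (V_plus N W)"
proof -
  have "majority N {e \<in> vertex_pairs N. x e} W i = 1 \<longleftrightarrow> i \<in> next_plus N x (V_plus N W)"
    if "i \<in> {1..N}" for i
    using majority_eq_next_plus[of N W i x] assms that by (simp add: label_def)
  then show ?thesis
    using next_plus_subset[of N x "V_plus N W"]
    unfolding V_plus_def[of N "majority N {e \<in> vertex_pairs N. x e} W"] by blast
qed

context homophily
begin

definition graph_pmf :: "nat \<Rightarrow> nat set \<Rightarrow> (nat set \<Rightarrow> bool) pmf" where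
  "graph_pmf N A =
     Pi_pmf (vertex_pairs N) False (\<lambda>e. bernoulli_pmf (if same_side A e then p else q))"

definition step :: "nat \<Rightarrow> nat set \<Rightarrow> nat set pmf" where
  "step N A = map_pmf (\<lambda>x. next_plus N x A) (graph_pmf N A)"

lemma SBM_eq_graph_pmf:
  assumes "\<And>i. i \<in> {1..N} \<Longrightarrow> W i \<in> {-1, 1}"
  shows "SBM p q N W = map_pmf (\<lambda>x. {e \<in> vertex_pairs N. x e}) (graph_pmf N (V_plus N W))"
proof -
  have "SBM p q N W = SBM p q N (label (V_plus N W))"
    using assms by (intro SBM_cong) (auto simp: label_def V_plus_def)
  then show ?thesis
    by (simp add: SBM_def graph_pmf_def same_side_def)
qed

text \<open>
  The part of the pressure on vertex \<open>i\<close> that comes from the vertices in \<open>J\<close>: the vertices of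
  the other opinion pull, those of the same opinion hold back.
\<close>

lemma prob_partial_pressure:
  assumes i: "i \<in> {1..N}" and J: "finite J" "J \<subseteq> {1..N} - {i}"
  shows "measure_pmf.prob (graph_pmf N A)
      {x. z \<le> (\<Sum>j\<in>J. if x {i, j} then - label A i * label A j else 0)} =
    tail (card {j \<in> J. j \<in> A \<longleftrightarrow> i \<in> A}) (card {j \<in> J. (j \<in> A) \<noteq> (i \<in> A)}) z"
  using J
proof (induction J arbitrary: z rule: finite_induct)
  case empty
  then show ?case by simp
next
  case (insert k J)
  define c where "c = - label A i * label A k"
  define S where "S x = (\<Sum>j\<in>J. if x {i, j} then - label A i * label A j else 0)" for x
  define r where "r = (if same_side A {i, k} then p else q)"
  let ?P = "measure_pmf.prob (graph_pmf N A)"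
  have e: "{i, k} \<in> vertex_pairs N"
    using i insert.prems by (auto simp: pair_in_vertex_pairs)
  have r01: "0 \<le> r" "r \<le> 1" using p_pos p_le_1 q_pos q_less_1 by (auto simp: r_def)
  have "map_pmf (\<lambda>f. f {i, k}) (graph_pmf N A) = bernoulli_pmf r"
    unfolding graph_pmf_def using e by (simp add: Pi_pmf_component r_def)
  then have "?P ((\<lambda>f. f {i, k}) -` {b}) = pmf (bernoulli_pmf r) b" for b
    by (simp add: pmf_map[symmetric])
  from this[of True] this[of False] have r: "?P {x. x {i, k}} = r" "?P {x. \<not> x {i, k}} = 1 - r"
    using r01 by (simp_all add: vimage_def)
  have indep: "?P {x. R (x {i, k}) \<and> z \<le> S x} = ?P {x. R (x {i, k})} * ?P {x. z \<le> S x}" for R z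
    unfolding graph_pmf_def
  proof (rule Pi_pmf_indep[where B = "{{i, k}}" and C = "(\<lambda>j. {i, j}) ` J"])
    show "(\<lambda>j. {i, j}) ` J \<subseteq> vertex_pairs N"
      using i insert.prems by (auto simp: pair_in_vertex_pairs)
    show "{{i, k}} \<inter> (\<lambda>j. {i, j}) ` J = {}"
      using insert.hyps insert.prems by (auto simp: doubleton_eq_iff)
    show "(z \<le> S f) = (z \<le> S g)" if "\<And>x. x \<in> (\<lambda>j. {i, j}) ` J \<Longrightarrow> f x = g x" for f g
      using that unfolding S_def by (intro arg_cong2[where f = "(\<le>)"] sum.cong refl) auto
  qed (use e in auto)
  have "{x. z \<le> (\<Sum>j\<in>insert k J. if x {i, j} then - label A i * label A j else 0)} =
      {x. x {i, k} \<and> z - c \<le> S x} \<union> {x. \<not> x {i, k} \<and> z \<le> S x}"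
    using insert.hyps by (auto simp: S_def c_def)
  also have "?P \<dots> = ?P {x. x {i, k} \<and> z - c \<le> S x} + ?P {x. \<not> x {i, k} \<and> z \<le> S x}"
    by (rule measure_pmf.finite_measure_Union) auto
  also have "\<dots> = r * ?P {x. z - c \<le> S x} + (1 - r) * ?P {x. z \<le> S x}"
    using indep[of "\<lambda>b. b" "z - c"] indep[of "\<lambda>b. \<not> b" z] r by simp
  also have "\<dots> = r * tail (card {j \<in> J. j \<in> A \<longleftrightarrow> i \<in> A}) (card {j \<in> J. (j \<in> A) \<noteq> (i \<in> A)}) (z - c) +
      (1 - r) * tail (card {j \<in> J. j \<in> A \<longleftrightarrow> i \<in> A}) (card {j \<in> J. (j \<in> A) \<noteq> (i \<in> A)}) z"
    using insert.IH insert.prems by (simp add: S_def)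
  also have "\<dots> = tail (card {j \<in> insert k J. j \<in> A \<longleftrightarrow> i \<in> A})
      (card {j \<in> insert k J. (j \<in> A) \<noteq> (i \<in> A)}) z"
  proof (cases "k \<in> A \<longleftrightarrow> i \<in> A")
    case True
    have "c = -1" "r = p"
      using True insert.prems by (auto simp: c_def r_def label_def same_side_pair)
    moreover have "{j \<in> insert k J. j \<in> A \<longleftrightarrow> i \<in> A} = insert k {j \<in> J. j \<in> A \<longleftrightarrow> i \<in> A}"
      "{j \<in> insert k J. (j \<in> A) \<noteq> (i \<in> A)} = {j \<in> J. (j \<in> A) \<noteq> (i \<in> A)}"
      using True by auto
    ultimately show ?thesis using insert.hyps by simp
  next
    case False
    have "c = 1" "r = q"
      using False insert.prems by (auto simp: c_def r_def label_def same_side_pair)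
    moreover have "{j \<in> insert k J. j \<in> A \<longleftrightarrow> i \<in> A} = {j \<in> J. j \<in> A \<longleftrightarrow> i \<in> A}"
      "{j \<in> insert k J. (j \<in> A) \<noteq> (i \<in> A)} = insert k {j \<in> J. (j \<in> A) \<noteq> (i \<in> A)}"
      using False by auto
    ultimately show ?thesis using insert.hyps by (simp add: tail_Suc_right)
  qed
  finally show ?case .
qed

lemma pressure_eq_sum:
  "pressure N x A i = (\<Sum>j\<in>{1..N} - {i}. if x {i, j} then - label A i * label A j else 0)"
  unfolding pressure_def field_def sum_distrib_left by (intro sum.cong) auto

lemma prob_pressure:
  assumes A: "A \<subseteq> {1..N}" and i: "i \<in> {1..N}"
  shows "measure_pmf.prob (graph_pmf N A) {x. z \<le> pressure N x A i} =
    (if i \<in> A then tail (card A - 1) (N - card A) z else tail (N - card A - 1) (card A) z)"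
proof -
  have fin: "finite A" using A by (auto intro: finite_subset)
  have cV: "card ({1..N} - A) = N - card A" using A fin by (simp add: card_Diff_subset)
  let ?J = "{1..N} - {i}"
  have "{x. z \<le> pressure N x A i} =
      {x. z \<le> (\<Sum>j\<in>?J. if x {i, j} then - label A i * label A j else 0)}"
    by (simp only: pressure_eq_sum)
  then have *: "measure_pmf.prob (graph_pmf N A) {x. z \<le> pressure N x A i} =
      tail (card {j \<in> ?J. j \<in> A \<longleftrightarrow> i \<in> A}) (card {j \<in> ?J. (j \<in> A) \<noteq> (i \<in> A)}) z"
    using prob_partial_pressure[OF i, of ?J A z] by simp
  show ?thesis
  proof (cases "i \<in> A")
    case True
    have "{j \<in> ?J. j \<in> A \<longleftrightarrow> i \<in> A} = A - {i}" "{j \<in> ?J. (j \<in> A) \<noteq> (i \<in> A)} = {1..N} - A"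
      using A i True by auto
    with * show ?thesis using True fin cV by (simp add: card_Diff_singleton)
  next
    case False
    have "{j \<in> ?J. j \<in> A \<longleftrightarrow> i \<in> A} = {1..N} - A - {i}" "{j \<in> ?J. (j \<in> A) \<noteq> (i \<in> A)} = A"
      using A i False by auto
    moreover have "card ({1..N} - A - {i}) = N - card A - 1"
      using cV i False by (subst card_Diff_singleton) auto
    ultimately show ?thesis using * False by simp
  qed
qed

text \<open>
  Two vertices share a single edge. Removing it changes either pressure by at most one and makes
  the pressures independent.
\<close>

lemma prob_two_flips:
  assumes A: "A \<subseteq> {1..N}" and ij: "i \<in> {1..N}" "j \<in> {1..N}" "i \<noteq> j"
  shows "measure_pmf.prob (graph_pmf N A) {x. i \<in> flips N x A \<and> j \<in> flips N x A} \<le>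
    measure_pmf.prob (graph_pmf N A) {x. 1 \<le> pressure N x A i} *
    measure_pmf.prob (graph_pmf N A) {x. -1 \<le> pressure N x A j}"
proof -
  let ?P = "measure_pmf.prob (graph_pmf N A)"
  define T where "T x = (\<Sum>k\<in>{1..N} - {j} - {i}. if x {j, k} then - label A j * label A k else 0)" for x
  have T: "pressure N x A j = (if x {j, i} then - label A j * label A i else 0) + T x" for x
    unfolding pressure_eq_sum T_def using ij by (subst sum.remove[of _ i]) auto
  have bd: "T x \<le> pressure N x A j + 1" "pressure N x A j \<le> T x + 1" for x
    unfolding T by (auto simp: label_def)
  have "?P {x. i \<in> flips N x A \<and> j \<in> flips N x A} \<le> ?P {x. 1 \<le> pressure N x A i \<and> 0 \<le> T x}"
  proof (rule measure_pmf.finite_measure_mono)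
    show "{x. i \<in> flips N x A \<and> j \<in> flips N x A} \<subseteq> {x. 1 \<le> pressure N x A i \<and> 0 \<le> T x}"
    proof safe
      fix x assume "i \<in> flips N x A" "j \<in> flips N x A"
      then show "1 \<le> pressure N x A i" "0 \<le> T x" using bd(2)[of x] by (auto simp: flips_def)
    qed
  qed simp
  also have "\<dots> = ?P {x. 1 \<le> pressure N x A i} * ?P {x. 0 \<le> T x}"
    unfolding graph_pmf_def
  proof (rule Pi_pmf_indep[where B = "(\<lambda>k. {i, k}) ` ({1..N} - {i})"
        and C = "(\<lambda>k. {j, k}) ` ({1..N} - {j} - {i})"])
    show "(\<lambda>k. {i, k}) ` ({1..N} - {i}) \<subseteq> vertex_pairs N"
      "(\<lambda>k. {j, k}) ` ({1..N} - {j} - {i}) \<subseteq> vertex_pairs N"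
      using ij by (auto simp: pair_in_vertex_pairs)
    show "(\<lambda>k. {i, k}) ` ({1..N} - {i}) \<inter> (\<lambda>k. {j, k}) ` ({1..N} - {j} - {i}) = {}"
      using ij by (auto simp: doubleton_eq_iff)
    show "(1 \<le> pressure N f A i) = (1 \<le> pressure N g A i)"
      if "\<And>x. x \<in> (\<lambda>k. {i, k}) ` ({1..N} - {i}) \<Longrightarrow> f x = g x" for f g
      using that unfolding pressure_eq_sum by (intro arg_cong2[where f = "(\<le>)"] sum.cong refl) auto
    show "(0 \<le> T f) = (0 \<le> T g)"
      if "\<And>x. x \<in> (\<lambda>k. {j, k}) ` ({1..N} - {j} - {i}) \<Longrightarrow> f x = g x" for f g
      using that unfolding T_def by (intro arg_cong2[where f = "(\<le>)"] sum.cong refl) auto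
  qed auto
  also have "\<dots> \<le> ?P {x. 1 \<le> pressure N x A i} * ?P {x. -1 \<le> pressure N x A j}"
  proof (intro mult_left_mono measure_pmf.finite_measure_mono)
    show "{x. 0 \<le> T x} \<subseteq> {x. - 1 \<le> pressure N x A j}"
    proof safe
      fix x assume "0 \<le> T x"
      then show "- 1 \<le> pressure N x A j" using bd(1)[of x] by linarith
    qed
  qed auto
  finally show ?thesis .
qed

end

section \<open>Rates of gaining and losing supporters\<close>

text \<open>
  A crude form of the inequality, over ordered pairs and with a common bound for all of them. It is
  good enough because simultaneous changes are of smaller order.
\<close>

lemma bonferroni:
  fixes \<delta> :: real
  assumes "finite I" and "0 \<le> \<delta>"
    and "\<And>i j. i \<in> I \<Longrightarrow> j \<in> I \<Longrightarrow> i \<noteq> j \<Longrightarrow> measure_pmf.prob M (E i \<inter> E j) \<le> \<delta>"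
  shows "(\<Sum>i\<in>I. measure_pmf.prob M (E i)) - real (card I) * real (card I) * \<delta> \<le> measure_pmf.prob M (\<Union>i\<in>I. E i)"
  using assms(1,3)
proof (induction I rule: finite_induct)
  case (insert k I)
  let ?U = "\<Union>i\<in>I. E i"
  have "measure_pmf.prob M (E k \<inter> ?U) = measure_pmf.prob M (\<Union>i\<in>I. E k \<inter> E i)"
    by simp
  also have "\<dots> \<le> (\<Sum>i\<in>I. measure_pmf.prob M (E k \<inter> E i))"
    using insert.hyps by (intro measure_pmf.finite_measure_subadditive_finite) auto
  also have "\<dots> \<le> (\<Sum>i\<in>I. \<delta>)"
  proof (rule sum_mono)
    fix i assume "i \<in> I"
    then show "measure_pmf.prob M (E k \<inter> E i) \<le> \<delta>"
      using insert.hyps by (intro insert.prems) auto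
  qed
  finally have "measure_pmf.prob M (E k \<inter> ?U) \<le> card I * \<delta>" by simp
  moreover have "measure_pmf.prob M (E k \<union> ?U) =
      measure_pmf.prob M (E k) + measure_pmf.prob M ?U - measure_pmf.prob M (E k \<inter> ?U)"
    by (rule measure_Un3) (auto simp: measure_pmf.fmeasurable_eq_sets)
  moreover have "(\<Sum>i\<in>I. measure_pmf.prob M (E i)) - real (card I) * real (card I) * \<delta> \<le> measure_pmf.prob M ?U"
    by (rule insert.IH, rule insert.prems) auto
  moreover have "(\<Sum>i\<in>insert k I. measure_pmf.prob M (E i)) =
      measure_pmf.prob M (E k) + (\<Sum>i\<in>I. measure_pmf.prob M (E i))"
    using insert.hyps by simp
  moreover have "real (card (insert k I)) * real (card (insert k I)) * \<delta> =
      real (card I) * real (card I) * \<delta> + card I * \<delta> + card I * \<delta> + \<delta>"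
    using insert.hyps by (simp add: algebra_simps)
  moreover have "0 \<le> card I * \<delta>" using \<open>0 \<le> \<delta>\<close> by simp
  ultimately have "(\<Sum>i\<in>insert k I. measure_pmf.prob M (E i)) -
      real (card (insert k I)) * real (card (insert k I)) * \<delta> \<le> measure_pmf.prob M (E k \<union> ?U)"
    using \<open>0 \<le> \<delta>\<close> by linarith
  then show ?case by simp
qed simp

context homophily
begin

definition p_lose :: "nat \<Rightarrow> nat set \<Rightarrow> real" where
  "p_lose N A = measure_pmf.prob (graph_pmf N A) {x. A \<inter> flips N x A \<noteq> {}}"

definition p_lose2 :: "nat \<Rightarrow> nat set \<Rightarrow> real" where
  "p_lose2 N A = measure_pmf.prob (graph_pmf N A) {x. 2 \<le> card (A \<inter> flips N x A)}"

definition p_gain :: "nat \<Rightarrow> nat set \<Rightarrow> real" where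
  "p_gain N A = measure_pmf.prob (graph_pmf N A) {x. A \<inter> flips N x A = {} \<and> flips N x A - A \<noteq> {}}"

definition small :: "nat \<Rightarrow> real" where
  "small N = exp (2 - conc_rate * N)"

context
  fixes N a b :: nat and A :: "nat set"
  assumes A: "A \<subseteq> {1..N}" and a: "a = card A" and b: "b = N - card A"
    and b1: "1 \<le> b" and ba: "b \<le> a"
begin

private lemma fin: "finite A" and N: "N = a + b" and cV: "card ({1..N} - A) = b"
proof -
  show "finite A" using A by (auto intro: finite_subset)
  then show "card ({1..N} - A) = b" using A b by (simp add: card_Diff_subset)
  show "N = a + b" using a b b1 by simp
qed

private lemma prob_flip_plus:
  assumes "i \<in> A"
  shows "measure_pmf.prob (graph_pmf N A) {x. z \<le> pressure N x A i} = tail (a - 1) b z"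
  unfolding prob_pressure[OF A subsetD[OF A assms]] a b using assms by simp

private lemma prob_flip_minus:
  assumes "i \<in> {1..N} - A"
  shows "measure_pmf.prob (graph_pmf N A) {x. z \<le> pressure N x A i} = tail (b - 1) a z"
  unfolding prob_pressure[OF A DiffD1[OF assms]] a b using assms by simp

private lemma eta: "tail (a - 1) b (-1) \<le> small N"
  using tail_majority_small[OF b1 ba] N by (simp add: small_def)

lemma p_lose_le: "p_lose N A \<le> a * tail (a - 1) b 1"
proof -
  have "p_lose N A \<le> measure_pmf.prob (graph_pmf N A) (\<Union>i\<in>A. {x. 1 \<le> pressure N x A i})"
    unfolding p_lose_def by (intro measure_pmf.finite_measure_mono) (auto simp: flips_def)
  also have "\<dots> \<le> (\<Sum>i\<in>A. measure_pmf.prob (graph_pmf N A) {x. 1 \<le> pressure N x A i})"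
    using fin by (intro measure_pmf.finite_measure_subadditive_finite) auto
  finally show ?thesis by (simp add: prob_flip_plus a)
qed

text \<open>
  Once one majority vertex has changed sides, a second one still does so only with exponentially
  small probability; this is what makes double losses negligible relative to gains.
\<close>

lemma p_lose2_le: "p_lose2 N A \<le> (real N)\<^sup>2 * (tail (a - 1) b 1 * small N)"
proof -
  let ?E = "\<lambda>(i, j). {x. i \<in> flips N x A \<and> j \<in> flips N x A}"
  let ?I = "{(i, j) \<in> A \<times> A. i \<noteq> j}"
  have fI: "finite ?I" using fin by (auto intro: finite_subset[of _ "A \<times> A"])
  have "p_lose2 N A \<le> measure_pmf.prob (graph_pmf N A) (\<Union>(ij)\<in>?I. ?E ij)"
    unfolding p_lose2_def
  proof (intro measure_pmf.finite_measure_mono subsetI)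
    fix x assume "x \<in> {x. 2 \<le> card (A \<inter> flips N x A)}"
    then have "\<not> card (A \<inter> flips N x A) \<le> Suc 0" by simp
    then obtain i j where "i \<in> A \<inter> flips N x A" "j \<in> A \<inter> flips N x A" "i \<noteq> j"
      using card_le_Suc0_iff_eq[of "A \<inter> flips N x A"] fin by blast
    then show "x \<in> (\<Union>ij\<in>?I. ?E ij)" by auto
  qed simp
  also have "\<dots> \<le> (\<Sum>ij\<in>?I. measure_pmf.prob (graph_pmf N A) (?E ij))"
    using fI by (intro measure_pmf.finite_measure_subadditive_finite) auto
  also have "\<dots> \<le> (\<Sum>ij\<in>?I. tail (a - 1) b 1 * small N)"
  proof (intro sum_mono)
    fix ij assume "ij \<in> ?I"
    then obtain i j where ij: "ij = (i, j)" "i \<in> A" "j \<in> A" "i \<noteq> j" by auto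
    have "measure_pmf.prob (graph_pmf N A) (?E ij) \<le> tail (a - 1) b 1 * tail (a - 1) b (-1)"
      using prob_two_flips[OF A subsetD[OF A ij(2)] subsetD[OF A ij(3)] ij(4)]
      unfolding prob_flip_plus[OF ij(2)] prob_flip_plus[OF ij(3)] ij(1) by simp
    also have "\<dots> \<le> tail (a - 1) b 1 * small N"
      by (intro mult_left_mono eta tail_nonneg)
    finally show "measure_pmf.prob (graph_pmf N A) (?E ij) \<le> tail (a - 1) b 1 * small N" .
  qed
  also have "\<dots> = card ?I * (tail (a - 1) b 1 * small N)" by simp
  also have "\<dots> \<le> (real N)\<^sup>2 * (tail (a - 1) b 1 * small N)"
  proof (intro mult_right_mono mult_nonneg_nonneg tail_nonneg)
    have "card ?I \<le> card (A \<times> A)" using fin by (intro card_mono) auto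
    also have "\<dots> \<le> N * N" using N a by (simp add: card_cartesian_product mult_le_mono)
    finally show "real (card ?I) \<le> (real N)\<^sup>2"
      unfolding power2_eq_square of_nat_mult[symmetric] of_nat_le_iff .
  qed (simp add: small_def)
  finally show ?thesis .
qed

private lemma p_gain_ge_union:
  "measure_pmf.prob (graph_pmf N A) (\<Union>i\<in>{1..N} - A. {x. 1 \<le> pressure N x A i})
      - (real N)\<^sup>2 * (tail (b - 1) a 1 * small N) \<le> p_gain N A"
proof -
  let ?P = "measure_pmf.prob (graph_pmf N A)"
  let ?E = "\<lambda>(i, j). {x. i \<in> flips N x A \<and> j \<in> flips N x A}"
  let ?I = "({1..N} - A) \<times> A"
  have fI: "finite ?I" using fin by auto
  have "?P (\<Union>i\<in>{1..N} - A. {x. 1 \<le> pressure N x A i}) \<le>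
      ?P ({x. A \<inter> flips N x A = {} \<and> flips N x A - A \<noteq> {}} \<union> (\<Union>(ij)\<in>?I. ?E ij))"
    by (intro measure_pmf.finite_measure_mono) (auto simp: flips_def)
  also have "\<dots> \<le> p_gain N A + ?P (\<Union>(ij)\<in>?I. ?E ij)"
    unfolding p_gain_def by (intro measure_Un_le) auto
  also have "?P (\<Union>(ij)\<in>?I. ?E ij) \<le> (\<Sum>ij\<in>?I. ?P (?E ij))"
    using fI by (intro measure_pmf.finite_measure_subadditive_finite) auto
  also have "\<dots> \<le> (\<Sum>ij\<in>?I. tail (b - 1) a 1 * small N)"
  proof (intro sum_mono)
    fix ij assume "ij \<in> ?I"
    then obtain i j where ij: "ij = (i, j)" "i \<in> {1..N} - A" "j \<in> A" by auto
    have "?P (?E ij) \<le> tail (b - 1) a 1 * tail (a - 1) b (-1)"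
      using prob_two_flips[OF A DiffD1[OF ij(2)] subsetD[OF A ij(3)]] ij
      unfolding prob_flip_minus[OF ij(2)] prob_flip_plus[OF ij(3)] ij(1) by auto
    also have "\<dots> \<le> tail (b - 1) a 1 * small N"
      by (intro mult_left_mono eta tail_nonneg)
    finally show "?P (?E ij) \<le> tail (b - 1) a 1 * small N" .
  qed
  also have "\<dots> = card ?I * (tail (b - 1) a 1 * small N)" by simp
  also have "\<dots> \<le> (real N)\<^sup>2 * (tail (b - 1) a 1 * small N)"
  proof (intro mult_right_mono mult_nonneg_nonneg tail_nonneg)
    have "card ?I \<le> N * N" unfolding card_cartesian_product cV using N a by (intro mult_le_mono) auto
    then show "real (card ?I) \<le> (real N)\<^sup>2"
      unfolding power2_eq_square of_nat_mult[symmetric] of_nat_le_iff .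
  qed (simp add: small_def)
  finally show ?thesis by simp
qed

text \<open>A single minority vertex suffices here; the correction is for simultaneous losses.\<close>

lemma p_gain_ge: "tail (b - 1) a 1 * (1 - (real N)\<^sup>2 * small N) \<le> p_gain N A"
proof -
  have "{1..N} - A \<noteq> {}" using cV b1 by (metis card.empty not_one_le_zero)
  then obtain i where i: "i \<in> {1..N} - A" by blast
  have "measure_pmf.prob (graph_pmf N A) {x. 1 \<le> pressure N x A i} \<le>
      measure_pmf.prob (graph_pmf N A) (\<Union>i\<in>{1..N} - A. {x. 1 \<le> pressure N x A i})"
    using i by (intro measure_pmf.finite_measure_mono) auto
  with p_gain_ge_union prob_flip_minus[OF i] show ?thesis by (simp add: algebra_simps)
qed

text \<open>
  Near a tie the number of potential gains matters, since it has to match the number of potential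
  losses. Here all minority vertices are stable, so that the changes of different vertices hardly
  overlap and their probabilities add up.
\<close>

lemma p_gain_ge_many:
  assumes lead: "real a - real b \<le> b * (p - q) / 2"
  shows "b * tail (b - 1) a 1 * (1 - 2 * (real N)\<^sup>2 * small N) \<le> p_gain N A"
proof -
  let ?P = "measure_pmf.prob (graph_pmf N A)"
  let ?\<beta> = "tail (b - 1) a 1"
  have \<beta>: "0 \<le> ?\<beta>" and sm: "0 \<le> small N" by (simp_all add: tail_nonneg small_def)
  have "(\<Sum>i\<in>{1..N} - A. ?P {x. 1 \<le> pressure N x A i}) - real b * real b * (?\<beta> * small N)
      \<le> ?P (\<Union>i\<in>{1..N} - A. {x. 1 \<le> pressure N x A i})"
    unfolding cV[symmetric]
  proof (rule bonferroni)
    fix i j assume ij: "i \<in> {1..N} - A" "j \<in> {1..N} - A" "i \<noteq> j"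
    have "?P ({x. 1 \<le> pressure N x A i} \<inter> {x. 1 \<le> pressure N x A j}) =
        ?P {x. i \<in> flips N x A \<and> j \<in> flips N x A}"
      using ij by (auto simp: flips_def intro!: arg_cong2[where f = measure_pmf.prob])
    also have "\<dots> \<le> ?\<beta> * tail (b - 1) a (-1)"
      using prob_two_flips[OF A DiffD1[OF ij(1)] DiffD1[OF ij(2)] ij(3)]
      unfolding prob_flip_minus[OF ij(1)] prob_flip_minus[OF ij(2)] .
    also have "\<dots> \<le> ?\<beta> * small N"
      using tail_minority_small[OF b1 ba lead] \<beta> N by (intro mult_left_mono) (auto simp: small_def)
    finally show "?P ({x. 1 \<le> pressure N x A i} \<inter> {x. 1 \<le> pressure N x A j})
        \<le> tail (card ({1..N} - A) - 1) a 1 * small N"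
      unfolding cV .
  next
    show "0 \<le> tail (card ({1..N} - A) - 1) a 1 * small N"
      using sm by (intro mult_nonneg_nonneg tail_nonneg)
  qed simp
  also have "(\<Sum>i\<in>{1..N} - A. ?P {x. 1 \<le> pressure N x A i}) = (\<Sum>i\<in>{1..N} - A. ?\<beta>)"
    by (intro sum.cong refl prob_flip_minus)
  also have "\<dots> = b * ?\<beta>" using cV by simp
  finally have "b * ?\<beta> - real b * real b * (?\<beta> * small N) - (real N)\<^sup>2 * (?\<beta> * small N) \<le> p_gain N A"
    using p_gain_ge_union by linarith
  moreover have "real b * real b * (?\<beta> * small N) \<le> b * ((real N)\<^sup>2 * (?\<beta> * small N))"
  proof -
    have "real b \<le> real N" using N by simp
    also have "\<dots> \<le> (real N)\<^sup>2" using b1 N by (simp add: power2_eq_square)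
    finally have "real b * (real b * (?\<beta> * small N)) \<le> real b * ((real N)\<^sup>2 * (?\<beta> * small N))"
      using \<beta> sm by (intro mult_left_mono mult_right_mono) auto
    then show ?thesis by (simp add: mult.assoc)
  qed
  moreover have "1 * ((real N)\<^sup>2 * (?\<beta> * small N)) \<le> b * ((real N)\<^sup>2 * (?\<beta> * small N))"
    using b1 \<beta> sm by (intro mult_right_mono) auto
  ultimately show ?thesis by (simp add: algebra_simps)
qed

end

text \<open>
  Close to a tie all vertices are stable and gains arrive at a rate
  proportional to the size of the minority; once the lead is proportional to \<open>N\<close>, the exponential
  advantage of a single minority vertex already beats the number of majority vertices.
\<close>

lemma rates:
  obtains r t N0 where "0 < r" "r < 1" "t \<longlonglongrightarrow> 0"
    "\<And>N A. N0 \<le> N \<Longrightarrow> A \<subseteq> {1..N} \<Longrightarrow> N \<le> 2 * card A \<Longrightarrow> card A < N \<Longrightarrow>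
       0 < p_gain N A \<and>
       p_lose N A \<le> (4 * r ^ (card A - (N - card A) - 3) + t N) * p_gain N A \<and>
       p_lose2 N A \<le> 2 * (real N)\<^sup>2 * small N * p_gain N A"
proof -
  obtain r where r: "0 < r" "r < 1" and ratio: "\<And>a b. 1 \<le> b \<Longrightarrow> b \<le> a \<Longrightarrow>
      tail (a - 1) b 1 \<le> r ^ (a - b - 3) * tail (b - 1) a 1"
    using flip_ratio by blast
  define g where "g = p - q"
  have g: "0 < g" "g \<le> 1" using q_less_p q_pos p_le_1 by (auto simp: g_def)
  define t where "t N = 2 * real N * r powr (g / 5 * N - 3)" for N :: nat
  define k d where "k = - ln r" and "d = k * g / 5"
  have "0 < k" using r by (simp add: k_def)
  then have kd: "0 < k" "0 < d" using g by (auto simp: d_def)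
  have "t = (\<lambda>N. 2 * real N * exp (3 * k - d * N))"
    using r by (simp add: t_def powr_def fun_eq_iff k_def d_def algebra_simps)
  also have "\<dots> \<longlonglongrightarrow> 0"
    using kd by real_asymp
  finally have "t \<longlonglongrightarrow> 0" .
  moreover have "(\<lambda>N. 2 * (real N)\<^sup>2 * small N) \<longlonglongrightarrow> 0"
    unfolding small_def using conc_rate_pos by real_asymp
  then have "eventually (\<lambda>N. 2 * (real N)\<^sup>2 * small N < 1 / 2) sequentially"
    by (rule order_tendstoD) simp
  then obtain N0 where N0: "\<And>N. N0 \<le> N \<Longrightarrow> 2 * (real N)\<^sup>2 * small N < 1 / 2"
    unfolding eventually_sequentially by blast
  moreover have "0 < p_gain N A \<and>
       p_lose N A \<le> (4 * r ^ (card A - (N - card A) - 3) + t N) * p_gain N A \<and>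
       p_lose2 N A \<le> 2 * (real N)\<^sup>2 * small N * p_gain N A"
    if N: "N0 \<le> N" and A: "A \<subseteq> {1..N}" and maj: "N \<le> 2 * card A" and nonc: "card A < N" for N A
  proof -
    define a b where "a = card A" and "b = N - card A"
    have b1: "1 \<le> b" and ba: "b \<le> a" and N_eq: "N = a + b"
      using maj nonc by (auto simp: a_def b_def)
    note hyps = A a_def b_def b1 ba
    let ?\<alpha> = "tail (a - 1) b 1" and ?\<beta> = "tail (b - 1) a 1"
    have sm: "0 \<le> small N" by (simp add: small_def)
    have \<beta>: "0 < ?\<beta>" using b1 ba by (intro tail_pos) auto
    have ab: "?\<alpha> \<le> r ^ (a - b - 3) * ?\<beta>" by (rule ratio[OF b1 ba])
    have gain: "?\<beta> \<le> 2 * p_gain N A"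
    proof -
      have "(real N)\<^sup>2 * small N \<le> 1 / 2" using N0[OF N] sm mult_nonneg_nonneg[OF zero_le_power2[of "real N"] sm] by linarith
      then have "?\<beta> * (1 / 2) \<le> ?\<beta> * (1 - (real N)\<^sup>2 * small N)"
        using \<beta> by (intro mult_left_mono) auto
      with p_gain_ge[OF hyps] show ?thesis by linarith
    qed
    have "?\<alpha> \<le> ?\<beta>"
    proof -
      have "r ^ (a - b - 3) * ?\<beta> \<le> 1 * ?\<beta>"
        using \<beta> r by (intro mult_right_mono) (auto simp: power_le_one)
      with ab show ?thesis by linarith
    qed
    then have "?\<alpha> \<le> 2 * p_gain N A" using gain by simp
    then have "(real N)\<^sup>2 * (?\<alpha> * small N) \<le> (real N)\<^sup>2 * ((2 * p_gain N A) * small N)"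
      using sm by (intro mult_left_mono mult_right_mono) auto
    then have lose2: "p_lose2 N A \<le> 2 * (real N)\<^sup>2 * small N * p_gain N A"
      using p_lose2_le[OF hyps] by (simp add: algebra_simps)
    have pos: "0 < p_gain N A" using \<beta> gain by simp
    have tpos: "0 \<le> t N" by (simp add: t_def)
    have lose: "p_lose N A \<le> (4 * r ^ (a - b - 3) + t N) * p_gain N A"
    proof (cases "real a - real b \<le> b * (p - q) / 2")
      case True
      have "?\<beta> * b * (1 / 2) \<le> ?\<beta> * b * (1 - 2 * (real N)\<^sup>2 * small N)"
        using N0[OF N] \<beta> by (intro mult_left_mono) auto
      with p_gain_ge_many[OF hyps True] have gain_b: "b * ?\<beta> \<le> 2 * p_gain N A"
        by (simp add: mult.commute)
      have a2b: "real a \<le> 2 * real b"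
        using True mult_left_mono[of "p - q" 1 "real b"] g by (simp add: g_def)
      have "a * ?\<alpha> \<le> (2 * real b) * (r ^ (a - b - 3) * ?\<beta>)"
        using ab a2b by (intro mult_mono tail_nonneg) auto
      also have "\<dots> = 2 * r ^ (a - b - 3) * (b * ?\<beta>)" by simp
      also have "\<dots> \<le> 2 * r ^ (a - b - 3) * (2 * p_gain N A)"
        using r gain_b by (intro mult_left_mono) auto
      also have "\<dots> \<le> (4 * r ^ (a - b - 3) + t N) * p_gain N A"
        using tpos pos by (simp add: algebra_simps)
      finally show ?thesis using p_lose_le[OF hyps] by linarith
    next
      case False
      then have lead: "b * g / 2 < real a - real b" by (simp add: g_def)
      have "g * (real a + real b) \<le> 5 * (real a - real b)"
      proof -
        have "g * (real a - real b) \<le> 1 * (real a - real b)"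
          using g ba by (intro mult_right_mono) auto
        with lead show ?thesis by (simp add: algebra_simps)
      qed
      then have "g / 5 * N - 3 \<le> real (a - b) - 3"
        unfolding N_eq using ba by (simp add: of_nat_diff)
      also have "\<dots> \<le> real (a - b - 3)" by linarith
      finally have "r powr real (a - b - 3) \<le> r powr (g / 5 * N - 3)"
        using r by (intro powr_mono') auto
      then have rp: "r ^ (a - b - 3) \<le> r powr (g / 5 * N - 3)"
        using r by (simp add: powr_realpow)
      have "a * ?\<alpha> \<le> real N * (r ^ (a - b - 3) * ?\<beta>)"
        using ab N_eq by (intro mult_mono tail_nonneg) auto
      also have "\<dots> \<le> real N * (r powr (g / 5 * N - 3) * (2 * p_gain N A))"
        using rp gain \<beta> by (intro mult_left_mono mult_mono) auto
      also have "\<dots> = t N * p_gain N A" by (simp add: t_def)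
      also have "\<dots> \<le> (4 * r ^ (a - b - 3) + t N) * p_gain N A"
        using r pos by (intro mult_right_mono) auto
      finally show ?thesis using p_lose_le[OF hyps] by linarith
    qed
    show ?thesis using pos lose lose2 by (simp add: a_def b_def)
  qed
  ultimately show thesis using that r by blast
qed

end

(* Otherwise the simplifier turns the vertex set {1..N} into {Suc 0..N}. *)
declare One_nat_def [simp del]

section \<open>A monotone and symmetric coupling\<close>

text \<open>
  Every pair of vertices carries two independent coins. The first one decides about the edge if
  the opinions differ; if they agree, the edge is also present when the second coin shows
  success. The same coins can then be used for all states at once.
\<close>

definition present :: "nat set \<Rightarrow> (nat set \<Rightarrow> bool \<times> bool) \<Rightarrow> nat set \<Rightarrow> bool" where
  "present A y e \<longleftrightarrow> fst (y e) \<or> (snd (y e) \<and> same_side A e)"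

definition coupled_next :: "nat \<Rightarrow> (nat set \<Rightarrow> bool \<times> bool) \<Rightarrow> nat set \<Rightarrow> nat set" where
  "coupled_next N y A = next_plus N (present A y) A"

lemma coupled_next_subset: "coupled_next N y A \<subseteq> {1..N}"
  unfolding coupled_next_def by (rule next_plus_subset)

lemma present_pair: "i \<noteq> j \<Longrightarrow>
    present A y {i, j} \<longleftrightarrow> fst (y {i, j}) \<or> (snd (y {i, j}) \<and> (i \<in> A \<longleftrightarrow> j \<in> A))"
  by (simp add: present_def same_side_pair)

text \<open>
  A vertex that joins \<open>+\<close> makes edges towards \<open>+\<close> more likely and edges towards \<open>-\<close> less likely;
  both increase the local fields, at the vertex itself and at its neighbours.
\<close>

lemma coupled_next_mono:
  assumes "A \<subseteq> B"
  shows "coupled_next N y A \<subseteq> coupled_next N y B"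
proof
  fix i assume i: "i \<in> coupled_next N y A"
  have "(if present A y {i, j} then label A j else 0) \<le> (if present B y {i, j} then label B j else 0)"
    if "i \<noteq> j" for j
    using that assms by (auto simp: present_pair label_def)
  then have "field N (present A y) A i \<le> field N (present B y) B i"
    unfolding field_def by (rule sum_mono) auto
  with i assms show "i \<in> coupled_next N y B"
    by (auto simp: coupled_next_def next_plus_def)
qed

lemma coupled_next_Diff:
  assumes "A \<subseteq> {1..N}"
  shows "coupled_next N y ({1..N} - A) = {1..N} - coupled_next N y A"
proof -
  have "field N (present ({1..N} - A) y) ({1..N} - A) i = - field N (present A y) A i"
    if i: "i \<in> {1..N}" for i
    unfolding field_def sum_negf[symmetric]
  proof (intro sum.cong refl)
    fix j assume j: "j \<in> {1..N} - {i}"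
    then have "present ({1..N} - A) y {i, j} = present A y {i, j}"
      using i by (subst (1 2) present_pair) auto
    moreover have "label ({1..N} - A) j = - label A j"
      using j by (simp add: label_def)
    ultimately show "(if present ({1..N} - A) y {i, j} then label ({1..N} - A) j else 0) =
        - (if present A y {i, j} then label A j else 0)"
      by simp
  qed
  then have "i \<in> coupled_next N y ({1..N} - A) \<longleftrightarrow> i \<notin> coupled_next N y A" if "i \<in> {1..N}" for i
    using that unfolding coupled_next_def next_plus_def by simp linarith
  then show ?thesis
    using coupled_next_subset[of N y] by blast
qed

lemma coupled_next_permute:
  assumes A: "A \<subseteq> {1..N}" and \<pi>: "\<pi> permutes {1..N}"
  shows "coupled_next N y (\<pi> ` A) = \<pi> ` coupled_next N (y \<circ> image \<pi>) A"
proof -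
  have inj: "\<pi> i = \<pi> j \<longleftrightarrow> i = j" for i j
    using permutes_inj[OF \<pi>] by (auto dest: injD)
  have mem: "\<pi> i \<in> \<pi> ` A \<longleftrightarrow> i \<in> A" for i
    by (auto simp: inj)
  have "field N (present (\<pi> ` A) y) (\<pi> ` A) (\<pi> i) = field N (present A (y \<circ> image \<pi>)) A i" for i
  proof -
    have "\<pi> ` ({1..N} - {i}) = {1..N} - {\<pi> i}"
      by (simp only: image_set_diff[OF permutes_inj[OF \<pi>]] permutes_image[OF \<pi>] image_insert image_empty)
    then have "bij_betw \<pi> ({1..N} - {i}) ({1..N} - {\<pi> i})"
      by (intro bij_betw_imageI inj_on_subset[OF permutes_inj[OF \<pi>]]) auto
    then have "field N (present (\<pi> ` A) y) (\<pi> ` A) (\<pi> i) =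
        (\<Sum>j\<in>{1..N} - {i}. if present (\<pi> ` A) y {\<pi> i, \<pi> j} then label (\<pi> ` A) (\<pi> j) else 0)"
      unfolding field_def by (rule sum.reindex_bij_betw[symmetric])
    also have "\<dots> = field N (present A (y \<circ> image \<pi>)) A i"
      unfolding field_def by (intro sum.cong) (auto simp: present_pair inj mem label_def)
    finally show ?thesis .
  qed
  then have *: "\<pi> i \<in> coupled_next N y (\<pi> ` A) \<longleftrightarrow> i \<in> coupled_next N (y \<circ> image \<pi>) A" for i
    by (simp add: coupled_next_def next_plus_def mem permutes_in_image[OF \<pi>] del: atLeastAtMost_iff)
  show ?thesis
  proof (intro set_eqI iffI)
    fix i assume i: "i \<in> coupled_next N y (\<pi> ` A)"
    have \<pi>_inv: "\<pi> (inv \<pi> i) = i" using permutes_inverses(1)[OF \<pi>] .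
    then have "inv \<pi> i \<in> coupled_next N (y \<circ> image \<pi>) A"
      using i *[of "inv \<pi> i"] by simp
    then show "i \<in> \<pi> ` coupled_next N (y \<circ> image \<pi>) A"
      by (rule rev_image_eqI) (rule \<pi>_inv[symmetric])
  qed (use * in auto)
qed

lemma permutation_into:
  assumes V: "finite V" and A: "A \<subseteq> V" and B: "B \<subseteq> V" and card: "card A \<le> card B"
  obtains \<pi> where "\<pi> permutes V" "\<pi> ` A \<subseteq> B"
proof -
  obtain C where C: "C \<subseteq> B" "card C = card A"
    by (rule obtain_subset_with_card_n[OF card])
  have fin: "finite A" "finite C" using V A B C by (meson finite_subset subset_trans)+
  obtain f where f: "bij_betw f A C"
    using finite_same_card_bij[OF fin] C by auto
  have "card (V - A) = card (V - C)"
    using card_Diff_subset[OF fin(1) A] card_Diff_subset[OF fin(2) subset_trans[OF C(1) B]] C(2)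
    by simp
  then obtain g where g: "bij_betw g (V - A) (V - C)"
    using finite_same_card_bij[of "V - A" "V - C"] V by auto
  define \<pi> where "\<pi> x = (if x \<in> A then f x else if x \<in> V then g x else x)" for x
  have "bij_betw \<pi> A C" "bij_betw \<pi> (V - A) (V - C)"
    using f g bij_betw_cong[of A \<pi> f C] bij_betw_cong[of "V - A" \<pi> g "V - C"]
    by (auto simp: \<pi>_def)
  then have "bij_betw \<pi> (A \<union> (V - A)) (C \<union> (V - C))"
    by (rule bij_betw_combine) auto
  moreover have "A \<union> (V - A) = V" "C \<union> (V - C) = V" using A B C by auto
  ultimately have "bij_betw \<pi> V V" by simp
  then have "\<pi> permutes V"
    by (rule bij_imp_permutes) (use A in \<open>auto simp: \<pi>_def\<close>)
  moreover have "\<pi> ` A \<subseteq> B"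
    using f C by (auto simp: \<pi>_def bij_betw_def)
  ultimately show thesis using that by blast
qed

context homophily
begin

definition coins :: "nat \<Rightarrow> (nat set \<Rightarrow> bool \<times> bool) pmf" where
  "coins N = Pi_pmf (vertex_pairs N) (False, False)
     (\<lambda>_. pair_pmf (bernoulli_pmf q) (bernoulli_pmf ((p - q) / (1 - q))))"

lemma coin_bias: "0 < (p - q) / (1 - q)" "(p - q) / (1 - q) \<le> 1"
  using q_less_p q_less_1 p_le_1 by auto

lemma bernoulli_or_pmf:
  "map_pmf (\<lambda>(u, v). u \<or> (v \<and> c)) (pair_pmf (bernoulli_pmf q) (bernoulli_pmf ((p - q) / (1 - q)))) =
    bernoulli_pmf (if c then p else q)" (is "map_pmf ?f ?M = _")
proof (cases c)
  case True
  let ?s = "(p - q) / (1 - q)"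
  have "measure_pmf.prob ?M (?f -` {False}) =
      measure_pmf.prob ?M ({False} \<times> {False})"
    using True by (intro arg_cong2[where f = measure_pmf.prob]) auto
  also have "\<dots> = (1 - q) * (1 - ?s)"
    unfolding measure_pmf_prob_pair using coin_bias q_pos q_less_1 by (simp add: measure_pmf_single)
  also have "\<dots> = 1 - p" using q_less_1 by (simp add: field_simps)
  finally have F: "pmf (map_pmf ?f ?M) False = 1 - p" by (simp add: pmf_map)
  show ?thesis
  proof (rule pmf_eqI)
    fix b
    have "pmf (map_pmf ?f ?M) True = 1 - pmf (map_pmf ?f ?M) False"
      by (rule pmf_True_conv_False)
    with F True show "pmf (map_pmf ?f ?M) b = pmf (bernoulli_pmf (if c then p else q)) b"
      using p_pos p_le_1 by (cases b) auto
  qed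
next
  case False
  then have "?f = fst" by auto
  with False show ?thesis by (simp add: map_fst_pair_pmf)
qed

lemma graph_pmf_coins: "graph_pmf N A = map_pmf (present A) (coins N)"
proof -
  let ?f = "\<lambda>e (u, v). u \<or> (v \<and> same_side A e)"
  have "graph_pmf N A = map_pmf (\<lambda>h e. if e \<in> vertex_pairs N then ?f e (h e) else False) (coins N)"
    unfolding graph_pmf_def bernoulli_or_pmf[symmetric] coins_def
    by (rule Pi_pmf_map_dep) simp
  also have "\<dots> = map_pmf (present A) (coins N)"
  proof (intro map_pmf_cong refl ext)
    fix y e assume "y \<in> set_pmf (coins N)"
    then have "y \<in> {y. \<forall>e. e \<notin> vertex_pairs N \<longrightarrow> y e = (False, False)}"
      unfolding coins_def by (rule subsetD[OF set_Pi_pmf_subset[OF finite_vertex_pairs]])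
    then show "(if e \<in> vertex_pairs N then ?f e (y e) else False) = present A y e"
      by (auto simp: present_def case_prod_beta)
  qed
  finally show ?thesis .
qed

lemma step_coins: "step N A = map_pmf (\<lambda>y. coupled_next N y A) (coins N)"
  by (simp add: step_def graph_pmf_coins map_pmf_comp coupled_next_def)

lemma finite_set_coins: "finite (set_pmf (coins N))"
proof -
  have "finite (set_pmf (Pi_pmf (vertex_pairs N) (False, False) w))"
    for w :: "_ \<Rightarrow> (bool \<times> bool) pmf"
    by (rule finite_subset[OF set_Pi_pmf_subset']) auto
  then show ?thesis by (simp add: coins_def)
qed

lemma integrable_coins [simp]: "integrable (measure_pmf (coins N)) (f :: _ \<Rightarrow> real)"
  by (rule integrable_measure_pmf_finite[OF finite_set_coins])

lemma coins_permute:
  assumes \<pi>: "\<pi> permutes {1..N}"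
  shows "coins N = map_pmf (\<lambda>y. y \<circ> image \<pi>) (coins N)"
  unfolding coins_def
proof (rule Pi_pmf_bij_betw)
  have inj: "inj \<pi>" using permutes_inj[OF \<pi>] .
  have img: "\<pi> ` e \<in> vertex_pairs N \<longleftrightarrow> e \<in> vertex_pairs N" for e
    using permutes_in_image[OF \<pi>] inj
    by (auto simp: vertex_pairs_def card_image inj_on_def inj_def image_subset_iff subset_iff
        simp del: atLeastAtMost_iff)
  show "\<pi> ` e \<notin> vertex_pairs N" if "e \<notin> vertex_pairs N" for e using img that by simp
  show "bij_betw (image \<pi>) (vertex_pairs N) (vertex_pairs N)"
  proof (rule bij_betwI')
    show "(\<pi> ` x = \<pi> ` y) = (x = y)" for x y using inj by (simp add: inj_image_eq_iff)
    show "\<exists>x\<in>vertex_pairs N. e = \<pi> ` x" if "e \<in> vertex_pairs N" for e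
    proof
      show e: "e = \<pi> ` inv \<pi> ` e"
        using permutes_surj[OF \<pi>] by (simp add: image_f_inv_f)
      show "inv \<pi> ` e \<in> vertex_pairs N" using that e img[of "inv \<pi> ` e"] by simp
    qed
  qed (simp add: img)
qed simp

section \<open>The winning probability as a function of the state\<close>

text \<open>
  \<open>win N t A\<close> is the probability of unanimity in favour of \<open>+\<close> after \<open>t\<close> days, computed by
  conditioning on the first day. This form inherits monotonicity and symmetry from a single step
  of the coupling.
\<close>

primrec win :: "nat \<Rightarrow> nat \<Rightarrow> nat set \<Rightarrow> real" where
  "win N 0 A = (if A = {1..N} then 1 else 0)"
| "win N (Suc t) A = measure_pmf.expectation (step N A) (win N t)"

lemma win_Suc: "win N (Suc t) A = measure_pmf.expectation (coins N) (\<lambda>y. win N t (coupled_next N y A))"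
  by (simp add: step_coins)

declare win.simps(2) [simp del]

lemma win_nonneg: "0 \<le> win N t A"
  by (induction t arbitrary: A) (auto simp: win_Suc)

lemma win_le_1: "win N t A \<le> 1"
proof (induction t arbitrary: A)
  case (Suc t)
  have "win N (Suc t) A \<le> measure_pmf.expectation (coins N) (\<lambda>_. 1)"
    unfolding win_Suc using Suc by (intro integral_mono) auto
  then show ?case by simp
qed auto

lemma win_mono:
  assumes "A \<subseteq> B" "B \<subseteq> {1..N}"
  shows "win N t A \<le> win N t B"
  using assms
proof (induction t arbitrary: A B)
  case (Suc t)
  then show ?case unfolding win_Suc
    by (intro integral_mono Suc.IH coupled_next_mono coupled_next_subset) auto
qed auto

lemma win_permute:
  assumes "A \<subseteq> {1..N}" and \<pi>: "\<pi> permutes {1..N}"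
  shows "win N t (\<pi> ` A) = win N t A"
  using assms(1)
proof (induction t arbitrary: A)
  case 0
  have "\<pi> ` A = {1..N} \<longleftrightarrow> A = {1..N}"
    using permutes_image[OF \<pi>] permutes_inj[OF \<pi>] by (metis inj_image_eq_iff)
  then show ?case by simp
next
  case (Suc t)
  have "win N (Suc t) (\<pi> ` A) =
      measure_pmf.expectation (coins N) (\<lambda>y. win N t (coupled_next N (y \<circ> image \<pi>) A))"
    unfolding win_Suc
    by (simp add: coupled_next_permute[OF Suc.prems \<pi>] Suc.IH[OF coupled_next_subset])
  also have "\<dots> = measure_pmf.expectation (map_pmf (\<lambda>y. y \<circ> image \<pi>) (coins N))
      (\<lambda>y. win N t (coupled_next N y A))"
    by simp
  also have "\<dots> = win N (Suc t) A"
    unfolding coins_permute[OF \<pi>, symmetric] by (rule win_Suc[symmetric])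
  finally show ?case .
qed

text \<open>By exchangeability, monotonicity in the state becomes monotonicity in its cardinality.\<close>

lemma win_card_mono:
  assumes "A \<subseteq> {1..N}" "B \<subseteq> {1..N}" "card A \<le> card B"
  shows "win N t A \<le> win N t B"
proof -
  obtain \<pi> where \<pi>: "\<pi> permutes {1..N}" "\<pi> ` A \<subseteq> B"
    using permutation_into[OF _ assms] by auto
  have "win N t A = win N t (\<pi> ` A)" using win_permute[OF assms(1) \<pi>(1)] by simp
  also have "\<dots> \<le> win N t B" using \<pi> assms by (intro win_mono)
  finally show ?thesis .
qed

lemma coupled_next_full: "coupled_next N y {1..N} = {1..N}"
proof -
  have "0 \<le> field N x {1..N} i" for x i
    unfolding field_def by (intro sum_nonneg) (auto simp: label_def)
  then show ?thesis by (auto simp: coupled_next_def next_plus_def order_le_less)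
qed

lemma coupled_next_empty: "coupled_next N y {} = {}"
  using coupled_next_Diff[of "{1..N}" N y] by (simp add: coupled_next_full)

lemma win_full: "win N t {1..N} = 1"
  by (induction t) (simp_all add: win_Suc coupled_next_full)

lemma win_empty: "1 \<le> N \<Longrightarrow> win N t {} = 0"
  by (induction t) (simp_all add: win_Suc coupled_next_empty)

lemma win_incseq: "incseq (\<lambda>t. win N t A)"
proof (rule incseq_SucI)
  show "win N t A \<le> win N (Suc t) A" for t
  proof (induction t arbitrary: A)
    case 0
    show ?case
      using win_nonneg[of N "Suc 0" A] win_full[of N "Suc 0"] by auto
  next
    case (Suc t)
    show ?case
      unfolding win_Suc[of N "Suc t"] win_Suc[of N t A] using Suc by (intro integral_mono) auto
  qed
qed

definition Win :: "nat \<Rightarrow> nat set \<Rightarrow> real" where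
  "Win N A = lim (\<lambda>t. win N t A)"

lemma win_LIMSEQ: "(\<lambda>t. win N t A) \<longlonglongrightarrow> Win N A"
proof -
  have "Bseq (\<lambda>t. win N t A)"
    using win_nonneg win_le_1 by (intro BseqI'[of _ 1]) auto
  then have "convergent (\<lambda>t. win N t A)"
    using win_incseq by (intro Bseq_mono_convergent) (auto simp: incseq_def)
  then show ?thesis by (simp add: Win_def convergent_LIMSEQ_iff)
qed

lemma Win_nonneg: "0 \<le> Win N A"
  by (rule LIMSEQ_le_const[OF win_LIMSEQ]) (auto simp: win_nonneg)

lemma Win_full: "Win N {1..N} = 1"
  using win_LIMSEQ[of N "{1..N}"] by (simp add: win_full LIMSEQ_const_iff)

lemma Win_card_mono:
  assumes "A \<subseteq> {1..N}" "B \<subseteq> {1..N}" "card A \<le> card B"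
  shows "Win N A \<le> Win N B"
  by (rule LIMSEQ_le[OF win_LIMSEQ win_LIMSEQ]) (use win_card_mono[OF assms] in auto)

lemma Win_harmonic: "Win N A = measure_pmf.expectation (coins N) (\<lambda>y. Win N (coupled_next N y A))"
proof -
  have E: "measure_pmf.expectation (coins N) f = (\<Sum>y\<in>set_pmf (coins N). pmf (coins N) y * f y)"
    for f :: "_ \<Rightarrow> real"
    by (subst integral_measure_pmf[OF finite_set_coins]) (auto simp: mult.commute)
  have "(\<lambda>t. win N (Suc t) A) \<longlonglongrightarrow> measure_pmf.expectation (coins N) (\<lambda>y. Win N (coupled_next N y A))"
    unfolding win_Suc E by (intro tendsto_intros win_LIMSEQ)
  moreover have "(\<lambda>t. win N (Suc t) A) \<longlonglongrightarrow> Win N A"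
    using win_LIMSEQ by (rule LIMSEQ_Suc)
  ultimately show ?thesis by (rule LIMSEQ_unique[rotated])
qed

end

section \<open>Absorption and a first advantage of the majority\<close>

text \<open>
  Two outcomes of the coins are used: the complete graph, which lets any strict majority win
  at once, and a hub joined to everybody while all other edges stay inside the two camps. The
  second one breaks ties.
\<close>

definition complete_coins :: "nat \<Rightarrow> nat set \<Rightarrow> bool \<times> bool" where
  "complete_coins N e = (e \<in> vertex_pairs N, e \<in> vertex_pairs N)"

definition hub_coins :: "nat \<Rightarrow> nat \<Rightarrow> nat set \<Rightarrow> bool \<times> bool" where
  "hub_coins N v e = (e \<in> vertex_pairs N \<and> v \<in> e, e \<in> vertex_pairs N)"

lemma sum_label:
  assumes "finite J"
  shows "(\<Sum>j\<in>J. label A j) = int (card (J \<inter> A)) - int (card (J - A))"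
proof -
  have "(\<Sum>j\<in>J. label A j) = (\<Sum>j\<in>J \<inter> A. label A j) + (\<Sum>j\<in>J - A. label A j)"
    using assms by (subst sum.Int_Diff[of J _ A]) auto
  also have "(\<Sum>j\<in>J \<inter> A. label A j) = (\<Sum>j\<in>J \<inter> A. 1)"
    by (intro sum.cong) (auto simp: label_def)
  also have "(\<Sum>j\<in>J - A. label A j) = (\<Sum>j\<in>J - A. -1)"
    by (intro sum.cong) (auto simp: label_def)
  finally show ?thesis by simp
qed

lemma card_Diff_interval: "A \<subseteq> {1..N} \<Longrightarrow> card ({1..N} - A) = N - card A"
  by (subst card_Diff_subset) (auto intro: finite_subset)

lemma card_le_interval: "A \<subseteq> {1..N} \<Longrightarrow> card A \<le> N"
  using card_mono[of "{1..N}" A] by simp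

lemma coupled_next_complete:
  assumes A: "A \<subseteq> {1..N}" and maj: "N < 2 * card A"
  shows "coupled_next N (complete_coins N) A = {1..N}"
proof -
  have fin: "finite A" using A by (auto intro: finite_subset)
  have "i \<in> coupled_next N (complete_coins N) A" if i: "i \<in> {1..N}" for i
  proof -
    have "field N (present A (complete_coins N)) A i = (\<Sum>j\<in>{1..N} - {i}. label A j)"
      unfolding field_def using i
      by (intro sum.cong) (auto simp: present_pair complete_coins_def pair_in_vertex_pairs)
    also have "\<dots> = (\<Sum>j\<in>{1..N}. label A j) - label A i"
      using i by (simp add: sum_diff1)
    also have "(\<Sum>j\<in>{1..N}. label A j) = int (card A) - int (N - card A)"
      using A by (simp add: sum_label card_Diff_interval Int_absorb1)
    finally have "field N (present A (complete_coins N)) A i = int (card A) - int (N - card A) - label A i" .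
    then show ?thesis
      using i maj by (auto simp: coupled_next_def next_plus_def label_def)
  qed
  then show ?thesis using coupled_next_subset by blast
qed

lemma coupled_next_complete_minority:
  assumes A: "A \<subseteq> {1..N}" and min: "2 * card A < N"
  shows "coupled_next N (complete_coins N) A = {}"
proof -
  have "coupled_next N (complete_coins N) ({1..N} - A) = {1..N}"
    using min by (intro coupled_next_complete) (auto simp: card_Diff_interval[OF A])
  then show ?thesis
    using coupled_next_Diff[of "{1..N} - A" N] A by (simp add: double_diff)
qed

lemma coupled_next_hub:
  assumes A: "A \<subseteq> {1..N}" and tie: "N = 2 * card A" and N: "3 \<le> N" and v: "v \<in> A"
  shows "coupled_next N (hub_coins N v) A = A - {v}"
proof -
  have fin: "finite A" using A by (auto intro: finite_subset)
  let ?x = "present A (hub_coins N v)"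
  have x: "?x {i, j} \<longleftrightarrow> i = v \<or> j = v \<or> (i \<in> A \<longleftrightarrow> j \<in> A)"
    if "i \<in> {1..N}" "j \<in> {1..N} - {i}" for i j
    using that by (subst present_pair) (auto simp: hub_coins_def pair_in_vertex_pairs)
  have "i \<in> coupled_next N (hub_coins N v) A \<longleftrightarrow> i \<in> A - {v}" if i: "i \<in> {1..N}" for i
  proof -
    consider "i = v" | "i \<in> A" "i \<noteq> v" | "i \<notin> A" by blast
    then show ?thesis
    proof cases
      case 1
      have "field N ?x A i = (\<Sum>j\<in>{1..N} - {i}. label A j)"
        unfolding field_def using 1 x[OF i] by (intro sum.cong) auto
      also have "\<dots> = (\<Sum>j\<in>{1..N}. label A j) - label A i"
        using i by (simp add: sum_diff1)
      also have "(\<Sum>j\<in>{1..N}. label A j) = 0"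
        using A tie by (simp add: sum_label card_Diff_interval Int_absorb1)
      finally have "field N ?x A i < 0" using 1 v by (simp add: label_def)
      with 1 show ?thesis by (simp add: coupled_next_def next_plus_def)
    next
      case 2
      have "field N ?x A i = (\<Sum>j\<in>{1..N} - {i}. if j \<in> A then 1 else 0)"
        unfolding field_def using 2 v by (intro sum.cong) (auto simp: x[OF i] label_def)
      also have "\<dots> = int (card (A - {i}))"
        using A by (subst sum.inter_restrict[symmetric]) (auto intro!: arg_cong[where f = card])
      finally have "0 < field N ?x A i"
        using 2 tie N fin by (simp add: card_Diff_singleton)
      with 2 i show ?thesis by (simp add: coupled_next_def next_plus_def)
    next
      case 3
      have "i \<noteq> v" using 3 v by auto
      have vV: "v \<in> {1..N}" using v A by auto
      have "field N ?x A i = (\<Sum>j\<in>{1..N} - {i}. (if j = v then 1 else 0) + (if j \<in> A then 0 else -1))"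
        unfolding field_def using 3 v by (intro sum.cong) (auto simp: x[OF i] label_def)
      also have "\<dots> = 1 + (\<Sum>j\<in>{1..N} - {i}. if j \<in> A then 0 else -1)"
        using \<open>i \<noteq> v\<close> vV by (simp add: sum.distrib)
      also have "(\<Sum>j\<in>{1..N} - {i}. if j \<in> A then 0 else -1) = (\<Sum>j\<in>{1..N} - A - {i}. - 1 :: int)"
        by (rule sum.mono_neutral_cong_right) auto
      also have "\<dots> = - int (card ({1..N} - A - {i}))" by simp
      also have "card ({1..N} - A - {i}) = N - card A - 1"
        using 3 i card_Diff_interval[OF A] by (subst card_Diff_singleton) auto
      finally have "field N ?x A i \<le> 0" using N tie by simp
      with 3 show ?thesis by (simp add: coupled_next_def next_plus_def)
    qed
  qed
  then show ?thesis
    using coupled_next_subset[of N] A by blast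
qed

context homophily
begin

text \<open>
  A lower bound for the probability of any possible outcome of the coins, which does not depend
  on the state of the process.
\<close>

definition min_atom :: "nat \<Rightarrow> real" where
  "min_atom N = Min (pmf (coins N) ` set_pmf (coins N))"

lemma min_atom_pos: "0 < min_atom N"
  unfolding min_atom_def using finite_set_coins[of N] set_pmf_not_empty[of "coins N"]
  by (subst Min_gr_iff) (auto simp: pmf_positive)

lemma min_atom_le_1: "min_atom N \<le> 1"
proof -
  obtain y where "y \<in> set_pmf (coins N)" using set_pmf_not_empty[of "coins N"] by blast
  then have "min_atom N \<le> pmf (coins N) y"
    unfolding min_atom_def using finite_set_coins by (intro Min_le) auto
  then show ?thesis using pmf_le_1[of "coins N" y] by linarith
qed

lemma expectation_ge_atom:
  assumes "y0 \<in> set_pmf (coins N)" and "\<And>y. 0 \<le> f y"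
  shows "min_atom N * f y0 \<le> measure_pmf.expectation (coins N) f"
proof -
  have "min_atom N \<le> pmf (coins N) y0"
    unfolding min_atom_def using finite_set_coins assms by (intro Min_le) auto
  then have "min_atom N * f y0 \<le> f y0 * pmf (coins N) y0"
    using assms(2)[of y0] by (simp add: mult.commute mult_left_mono)
  also have "\<dots> \<le> (\<Sum>y\<in>set_pmf (coins N). f y * pmf (coins N) y)"
    using finite_set_coins assms by (intro member_le_sum) auto
  also have "\<dots> = measure_pmf.expectation (coins N) f"
    by (subst integral_measure_pmf[OF finite_set_coins]) (auto simp: mult.commute)
  finally show ?thesis .
qed

lemma coins_support:
  assumes "\<And>e. e \<notin> vertex_pairs N \<Longrightarrow> y e = (False, False)"
    and "\<And>e. e \<in> vertex_pairs N \<Longrightarrow> snd (y e)"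
  shows "y \<in> set_pmf (coins N)"
proof -
  have "(u, True) \<in> set_pmf (pair_pmf (bernoulli_pmf q) (bernoulli_pmf ((p - q) / (1 - q))))" for u
  proof -
    have "True \<in> set_pmf (bernoulli_pmf ((p - q) / (1 - q)))"
      using coin_bias q_less_p q_less_1 by (simp add: set_pmf_iff)
    moreover have "u \<in> set_pmf (bernoulli_pmf q)"
      using q_pos q_less_1 by (simp add: set_pmf_bernoulli)
    ultimately show ?thesis by simp
  qed
  then have "y e \<in> set_pmf (pair_pmf (bernoulli_pmf q) (bernoulli_pmf ((p - q) / (1 - q))))"
    if "e \<in> vertex_pairs N" for e
    using assms(2)[OF that] by (metis prod.collapse)
  with assms(1) show ?thesis
    unfolding coins_def set_Pi_pmf[OF finite_vertex_pairs] PiE_dflt_def by simp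
qed

lemma complete_coins_support: "complete_coins N \<in> set_pmf (coins N)"
  by (rule coins_support) (simp_all add: complete_coins_def)

lemma hub_coins_support: "hub_coins N v \<in> set_pmf (coins N)"
  by (rule coins_support) (simp_all add: hub_coins_def)

definition undecided :: "nat \<Rightarrow> nat \<Rightarrow> nat set \<Rightarrow> real" where
  "undecided N t A = 1 - win N t A - win N t ({1..N} - A)"

lemma undecided_Suc:
  assumes "A \<subseteq> {1..N}"
  shows "undecided N (Suc t) A = measure_pmf.expectation (coins N) (\<lambda>y. undecided N t (coupled_next N y A))"
  unfolding undecided_def win_Suc coupled_next_Diff[OF assms] by simp

lemma undecided_nonneg:
  assumes "1 \<le> N" "A \<subseteq> {1..N}"
  shows "0 \<le> undecided N t A"
  using assms(2)
proof (induction t arbitrary: A)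
  case 0
  have "\<not> (A = {1..N} \<and> {1..N} - A = {1..N})" using assms(1) by auto
  then show ?case unfolding undecided_def win.simps(1) by argo
next
  case (Suc t)
  show ?case
    unfolding undecided_Suc[OF Suc.prems]
    by (rule Bochner_Integration.integral_nonneg) (rule Suc.IH[OF coupled_next_subset])
qed

lemma undecided_le:
  assumes "A \<subseteq> {1..N}" and "\<And>B. B \<subseteq> {1..N} \<Longrightarrow> undecided N t B \<le> M"
  shows "undecided N (Suc t) A \<le> M"
proof -
  have "undecided N (Suc t) A \<le> measure_pmf.expectation (coins N) (\<lambda>_. M)"
    unfolding undecided_Suc[OF assms(1)] by (intro integral_mono assms coupled_next_subset) auto
  then show ?thesis by simp
qed

lemma undecided_gap:
  assumes A: "A \<subseteq> {1..N}" and M: "\<And>B. B \<subseteq> {1..N} \<Longrightarrow> undecided N t B \<le> M"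
    and y: "y0 \<in> set_pmf (coins N)"
  shows "undecided N (Suc t) A \<le> M - min_atom N * (M - undecided N t (coupled_next N y0 A))"
proof -
  have "min_atom N * (M - undecided N t (coupled_next N y0 A)) \<le>
      measure_pmf.expectation (coins N) (\<lambda>y. M - undecided N t (coupled_next N y A))"
    by (rule expectation_ge_atom[OF y]) (simp add: M[OF coupled_next_subset])
  also have "\<dots> = M - undecided N (Suc t) A"
    unfolding undecided_Suc[OF A] by simp
  finally show ?thesis by simp
qed

lemma undecided_strict:
  assumes N: "1 \<le> N" and A: "A \<subseteq> {1..N}" and M: "\<And>B. B \<subseteq> {1..N} \<Longrightarrow> undecided N t B \<le> M"
    and "2 * card A \<noteq> N"
  shows "undecided N (Suc t) A \<le> (1 - min_atom N) * M"
proof -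
  have "coupled_next N (complete_coins N) A \<in> {{}, {1..N}}"
    using assms(4) coupled_next_complete[OF A] coupled_next_complete_minority[OF A]
    by (cases "2 * card A < N") auto
  then have "undecided N t (coupled_next N (complete_coins N) A) = 0"
    using N by (auto simp: undecided_def win_full win_empty)
  with undecided_gap[OF A M complete_coins_support] show ?thesis by (simp add: algebra_simps)
qed

text \<open>
  Every two days bring unanimity with a probability that is bounded below, so it is reached almost
  surely. With two vertices this would be false: they may disagree forever.
\<close>

lemma Win_complement:
  assumes N: "3 \<le> N" and A: "A \<subseteq> {1..N}"
  shows "Win N A + Win N ({1..N} - A) = 1"
proof -
  let ?\<rho> = "min_atom N"
  have \<rho>: "0 < ?\<rho>" "?\<rho> \<le> 1" by (rule min_atom_pos min_atom_le_1)+
  have bound: "undecided N (2 * s) A \<le> (1 - ?\<rho> * ?\<rho>) ^ s" if "A \<subseteq> {1..N}" for s A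
    using that
  proof (induction s arbitrary: A)
    case 0
    then show ?case using win_nonneg[of N 0] by (simp add: undecided_def)
  next
    case (Suc s)
    define M where "M = (1 - ?\<rho> * ?\<rho>) ^ s"
    have \<rho>2: "0 \<le> 1 - ?\<rho> * ?\<rho>" "?\<rho> * ?\<rho> \<le> ?\<rho>" using \<rho> by (simp_all add: mult_le_one)
    have M: "undecided N (2 * s) B \<le> M" if "B \<subseteq> {1..N}" for B
      unfolding M_def by (rule Suc.IH[OF that])
    have M0: "0 \<le> M" using \<rho>2 by (simp add: M_def)
    have M1: "undecided N (Suc (2 * s)) B \<le> M" if "B \<subseteq> {1..N}" for B
      using undecided_le[OF that M] by simp
    \<comment> \<open>Two days are needed: from a tie, the hub only creates a strict majority.\<close>
    have "undecided N (Suc (Suc (2 * s))) A \<le> (1 - ?\<rho> * ?\<rho>) * M"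
    proof (cases "2 * card A = N")
      case False
      have "undecided N (Suc (Suc (2 * s))) A \<le> (1 - ?\<rho>) * M"
        using N False by (intro undecided_strict Suc.prems M1) auto
      also have "\<dots> \<le> (1 - ?\<rho> * ?\<rho>) * M"
        using \<rho>2 M0 by (intro mult_right_mono) auto
      finally show ?thesis .
    next
      case True
      then have "A \<noteq> {}" using N by auto
      then obtain v where v: "v \<in> A" by blast
      have fin: "finite A" using Suc.prems by (auto intro: finite_subset)
      have sub: "A - {v} \<subseteq> {1..N}" using Suc.prems by auto
      have c: "card (A - {v}) < card A" using fin v by (rule card_Diff1_less)
      have "undecided N (Suc (2 * s)) (A - {v}) \<le> (1 - ?\<rho>) * M"
        using N True c by (intro undecided_strict sub M) auto
      then have "?\<rho> * (?\<rho> * M) \<le> ?\<rho> * (M - undecided N (Suc (2 * s)) (A - {v}))"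
        using \<rho> by (intro mult_left_mono) (auto simp: algebra_simps)
      with undecided_gap[OF Suc.prems M1 hub_coins_support[of N v]]
        coupled_next_hub[OF Suc.prems True[symmetric] N v]
      show ?thesis by (simp add: algebra_simps)
    qed
    then show ?case by (simp add: M_def)
  qed
  have "(\<lambda>t. undecided N t A) \<longlonglongrightarrow> 1 - Win N A - Win N ({1..N} - A)"
    unfolding undecided_def by (intro tendsto_intros win_LIMSEQ)
  moreover have "strict_mono (\<lambda>s::nat. 2 * s)" by (simp add: strict_mono_def)
  ultimately have lim: "(\<lambda>s. undecided N (2 * s) A) \<longlonglongrightarrow> 1 - Win N A - Win N ({1..N} - A)"
    using LIMSEQ_subseq_LIMSEQ[of "\<lambda>t. undecided N t A" _ "\<lambda>s. 2 * s"] by (simp add: o_def)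
  have "?\<rho> * ?\<rho> \<le> 1" using \<rho> by (simp add: mult_le_one)
  moreover have "0 < ?\<rho> * ?\<rho>" using \<rho> by simp
  ultimately have "(\<lambda>s. (1 - ?\<rho> * ?\<rho>) ^ s) \<longlonglongrightarrow> 0" by (intro LIMSEQ_power_zero) auto
  then have "(\<lambda>s. undecided N (2 * s) A) \<longlonglongrightarrow> 0"
    by (rule tendsto_sandwich[rotated 2, OF tendsto_const])
      (use undecided_nonneg[OF _ A] bound[OF A] N in auto)
  with lim have "1 - Win N A - Win N ({1..N} - A) = 0" by (rule LIMSEQ_unique)
  then show ?thesis by simp
qed

definition advantage :: "nat \<Rightarrow> nat set \<Rightarrow> real" where
  "advantage N A = Win N A - Win N ({1..N} - A)"

text \<open>
  If \<open>A\<close> is a strict majority, it contains a set \<open>B\<close> as large as its complement. Coupled processes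
  started from \<open>A\<close> and \<open>B\<close> stay ordered, and a complete graph on the first day makes \<open>+\<close> win in the
  one and lose in the other.
\<close>

lemma advantage_pos:
  assumes A: "A \<subseteq> {1..N}" and maj: "N < 2 * card A"
  shows "min_atom N \<le> advantage N A"
proof -
  have fin: "finite A" using A by (auto intro: finite_subset)
  have N: "1 \<le> N" using card_le_interval[OF A] maj by simp
  obtain B where B: "B \<subseteq> A" "card B = N - card A"
  proof (rule obtain_subset_with_card_n)
    show "N - card A \<le> card A" using maj by simp
  qed
  have BV: "B \<subseteq> {1..N}" using A B by auto
  have "min_atom N \<le> win N (Suc t) A - win N (Suc t) ({1..N} - A)" for t
  proof -
    let ?f = "\<lambda>y. win N t (coupled_next N y A) - win N t (coupled_next N y B)"
    have "?f (complete_coins N) = 1"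
      using coupled_next_complete[OF A maj] coupled_next_complete_minority[OF BV] B maj
        card_le_interval[OF A] N
      by (simp add: win_full win_empty)
    then have "min_atom N \<le> measure_pmf.expectation (coins N) ?f"
      using expectation_ge_atom[OF complete_coins_support[of N], of ?f]
        win_mono[OF coupled_next_mono[OF B(1)] coupled_next_subset] by simp
    also have "\<dots> = win N (Suc t) A - win N (Suc t) B"
      by (simp add: win_Suc)
    also have "win N (Suc t) B = win N (Suc t) ({1..N} - A)"
      using B card_Diff_interval[OF A] BV by (intro antisym win_card_mono) auto
    finally show ?thesis .
  qed
  moreover have "(\<lambda>t. win N (Suc t) A - win N (Suc t) ({1..N} - A)) \<longlonglongrightarrow> advantage N A"
    unfolding advantage_def by (intro tendsto_intros LIMSEQ_Suc win_LIMSEQ)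
  ultimately show ?thesis by (intro LIMSEQ_le_const) auto
qed

end

section \<open>A large lead decides the process\<close>

context homophily
begin

lemma expectation_coins_graph:
  "measure_pmf.expectation (coins N) (\<lambda>y. f (coupled_next N y A)) =
    measure_pmf.expectation (graph_pmf N A) (\<lambda>x. f (next_plus N x A))"
  for f :: "nat set \<Rightarrow> real"
  by (simp add: graph_pmf_coins coupled_next_def)

lemma integrable_graph_pmf [simp]: "integrable (measure_pmf (graph_pmf N A)) (f :: _ \<Rightarrow> real)"
  by (rule integrable_measure_pmf_finite) (simp add: graph_pmf_coins finite_set_coins)

text \<open>
  All estimates of one day go through this lemma: it reduces them to a case distinction on the
  numbers of lost and gained vertices.
\<close>

lemma expectation_ge_events:
  fixes f :: "nat set \<Rightarrow> real"
  assumes "\<And>x. c + cg * of_bool (A \<inter> flips N x A = {} \<and> flips N x A - A \<noteq> {})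
      + cl * of_bool (A \<inter> flips N x A \<noteq> {}) + cl2 * of_bool (2 \<le> card (A \<inter> flips N x A))
      \<le> f (next_plus N x A)"
  shows "c + cg * p_gain N A + cl * p_lose N A + cl2 * p_lose2 N A
    \<le> measure_pmf.expectation (coins N) (\<lambda>y. f (coupled_next N y A))"
proof -
  have ind: "measure_pmf.expectation (graph_pmf N A) (\<lambda>x. of_bool (P x)) =
      measure_pmf.prob (graph_pmf N A) {x. P x}" for P
  proof -
    have "(\<lambda>x. of_bool (P x) :: real) = indicat_real {x. P x}"
      by (auto simp: indicator_def)
    then show ?thesis by simp
  qed
  have "measure_pmf.expectation (graph_pmf N A) (\<lambda>x.
      c + cg * of_bool (A \<inter> flips N x A = {} \<and> flips N x A - A \<noteq> {})
      + cl * of_bool (A \<inter> flips N x A \<noteq> {}) + cl2 * of_bool (2 \<le> card (A \<inter> flips N x A))) =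
      c + cg * p_gain N A + cl * p_lose N A + cl2 * p_lose2 N A"
    unfolding p_gain_def p_lose_def p_lose2_def ind[symmetric] by simp
  moreover have "measure_pmf.expectation (graph_pmf N A) (\<lambda>x.
      c + cg * of_bool (A \<inter> flips N x A = {} \<and> flips N x A - A \<noteq> {})
      + cl * of_bool (A \<inter> flips N x A \<noteq> {}) + cl2 * of_bool (2 \<le> card (A \<inter> flips N x A)))
      \<le> measure_pmf.expectation (graph_pmf N A) (\<lambda>x. f (next_plus N x A))"
    using assms by (intro integral_mono) auto
  ultimately show ?thesis unfolding expectation_coins_graph by simp
qed

text \<open>
  Natural-number subtraction makes this potential equal to \<open>1\<close> whenever the lead is at most \<open>K\<close>.
\<close>

definition potential :: "real \<Rightarrow> nat \<Rightarrow> nat \<Rightarrow> nat set \<Rightarrow> real" where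
  "potential \<theta> K N A = \<theta> ^ (card A - (N - card A) - K)"

lemma potential_step:
  assumes \<theta>: "0 < \<theta>" "\<theta> < 1" and A: "A \<subseteq> {1..N}" and lead: "K < card A - (N - card A)"
  shows "potential \<theta> K N (next_plus N x A) \<le> potential \<theta> K N A * (1
      - (1 - \<theta>\<^sup>2) * of_bool (A \<inter> flips N x A = {} \<and> flips N x A - A \<noteq> {})
      + (1 / \<theta>\<^sup>2 - 1) * of_bool (A \<inter> flips N x A \<noteq> {})
      + 1 / \<theta> ^ N * of_bool (2 \<le> card (A \<inter> flips N x A)))"
proof -
  define a' u w where "a' = card (next_plus N x A)" and "u = card (A \<inter> flips N x A)"
    and "w = card (flips N x A - A)"
  have fin: "finite A" "finite (flips N x A)" using A by (auto intro: finite_subset simp: flips_def)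
  have eq: "a' + u = card A + w"
    using card_next_plus[OF A] by (simp add: a'_def u_def w_def)
  have a'N: "a' \<le> N"
    unfolding a'_def by (rule card_le_interval[OF next_plus_subset])
  have aN: "card A \<le> N" by (rule card_le_interval[OF A])
  define d where "d = card A - (N - card A) - K"
  have d: "d \<le> N" using aN by (simp add: d_def)
  have u0: "A \<inter> flips N x A = {} \<longleftrightarrow> u = 0" and w0: "flips N x A - A = {} \<longleftrightarrow> w = 0"
    using fin by (auto simp: u_def w_def)
  have 1: "1 \<le> 1 / \<theta>\<^sup>2" using \<theta> by (simp add: power_le_one)
  have "\<theta> ^ (a' - (N - a') - K) \<le> \<theta> ^ d * (1
      - (1 - \<theta>\<^sup>2) * of_bool (u = 0 \<and> w \<noteq> 0)
      + (1 / \<theta>\<^sup>2 - 1) * of_bool (u \<noteq> 0)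
      + 1 / \<theta> ^ N * of_bool (2 \<le> u))"
  proof -
    consider "u = 0" "w = 0" | "u = 0" "w \<noteq> 0" | "u = 1" | "2 \<le> u" by linarith
    then show ?thesis
    proof cases
      case 1
      then show ?thesis using eq by (simp add: d_def)
    next
      case 2
      have "d + 2 \<le> a' - (N - a') - K" using eq 2 lead aN a'N by (simp add: d_def)
      then have "\<theta> ^ (a' - (N - a') - K) \<le> \<theta> ^ (d + 2)"
        using \<theta> by (intro power_decreasing) auto
      with 2 show ?thesis by (simp add: power_add power2_eq_square mult_ac)
    next
      case 3
      have "d - 2 \<le> a' - (N - a') - K" using eq 3 lead aN a'N by (simp add: d_def)
      then have "\<theta> ^ (a' - (N - a') - K) \<le> \<theta> ^ (d - 2)"
        using \<theta> by (intro power_decreasing) auto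
      moreover have "\<theta> ^ (d - 2) * \<theta>\<^sup>2 \<le> \<theta> ^ d"
        unfolding power_add[symmetric] using \<theta> by (intro power_decreasing) auto
      then have "\<theta> ^ (d - 2) \<le> \<theta> ^ d * (1 / \<theta>\<^sup>2)"
        using \<theta> by (simp add: field_simps)
      ultimately show ?thesis using 3 by simp
    next
      case 4
      have "\<theta> ^ N \<le> \<theta> ^ d" using \<theta> d by (intro power_decreasing) auto
      then have "1 \<le> \<theta> ^ d * (1 / \<theta> ^ N)" using \<theta> by (simp add: field_simps)
      moreover have "\<theta> ^ d * (1 / \<theta> ^ N) \<le> \<theta> ^ d * (1 / \<theta>\<^sup>2 + 1 / \<theta> ^ N)"
        using \<theta> by (intro mult_left_mono) auto
      moreover have "\<theta> ^ (a' - (N - a') - K) \<le> 1" using \<theta> by (simp add: power_le_one)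
      ultimately show ?thesis using 4 by simp
    qed
  qed
  then show ?thesis
    unfolding potential_def u0 w0 u_def[symmetric] a'_def[symmetric] d_def[symmetric] by simp
qed

text \<open>
  A gain lowers the potential by the factor \<open>\<theta>\<^sup>2\<close> or more, and beyond the lead \<open>K\<close> single losses
  are too rare to make up for this. A loss of two vertices could send it back to \<open>1\<close>, that is,
  multiply it by as much as \<open>1 / \<theta> ^ N\<close>; so \<open>\<theta>\<close> must be close enough to \<open>1\<close> for this to be
  outweighed by the relative rarity of double losses.
\<close>

lemma potential_superharmonic:
  obtains \<theta> K N0 where "0 < \<theta>" "\<theta> < 1"
    "\<And>N A. N0 \<le> N \<Longrightarrow> A \<subseteq> {1..N} \<Longrightarrow>
      measure_pmf.expectation (coins N) (\<lambda>y. potential \<theta> K N (coupled_next N y A)) \<le> potential \<theta> K N A"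
proof -
  obtain r t N1 where r: "0 < r" "r < 1" and t: "t \<longlonglongrightarrow> 0" and
    rates: "\<And>N A. N1 \<le> N \<Longrightarrow> A \<subseteq> {1..N} \<Longrightarrow> N \<le> 2 * card A \<Longrightarrow> card A < N \<Longrightarrow>
       0 < p_gain N A \<and>
       p_lose N A \<le> (4 * r ^ (card A - (N - card A) - 3) + t N) * p_gain N A \<and>
       p_lose2 N A \<le> 2 * (real N)\<^sup>2 * small N * p_gain N A"
    using rates by blast
  \<comment> \<open>Then \<open>1 / \<theta> ^ N\<close> grows only at half the rate at which double losses get rarer.\<close>
  define \<theta> where "\<theta> = exp (- conc_rate / 2)"
  have \<theta>: "0 < \<theta>" "\<theta> < 1" using conc_rate_pos by (auto simp: \<theta>_def)
  then have \<theta>2: "0 < \<theta>\<^sup>2" "\<theta>\<^sup>2 < 1" by (auto simp: power_less_one_iff)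
  have "(\<lambda>k. 4 * r ^ k) \<longlonglongrightarrow> 4 * 0"
    using r by (intro tendsto_mult tendsto_const LIMSEQ_power_zero) auto
  then have "eventually (\<lambda>k. 4 * r ^ k < \<theta>\<^sup>2 / 4) sequentially"
    by (rule order_tendstoD) (use \<theta>2 in simp)
  then obtain k where k: "4 * r ^ k < \<theta>\<^sup>2 / 4"
    unfolding eventually_sequentially by blast
  define K where "K = k + 3"
  have "eventually (\<lambda>N. t N < \<theta>\<^sup>2 / 4) sequentially"
    using t \<theta>2 by (intro order_tendstoD(2)) auto
  moreover have "(\<lambda>N. 1 / \<theta> ^ N * (2 * (real N)\<^sup>2 * small N)) \<longlonglongrightarrow> 0"
  proof -
    have "1 / \<theta> ^ N * (2 * (real N)\<^sup>2 * small N) = 2 * (real N)\<^sup>2 * exp (2 - conc_rate / 2 * N)" for N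
    proof -
      have "\<theta> ^ N = exp (- (conc_rate / 2 * N))"
        unfolding \<theta>_def by (simp add: exp_of_nat_mult[symmetric] mult.commute)
      then have "1 / \<theta> ^ N * small N = exp (conc_rate / 2 * N) * exp (2 - conc_rate * N)"
        by (simp only: small_def exp_minus) (simp add: field_simps)
      also have "\<dots> = exp (2 - conc_rate / 2 * N)"
        by (simp add: exp_add[symmetric])
      finally have *: "exp (2 - conc_rate / 2 * N) = 1 / \<theta> ^ N * small N" ..
      show ?thesis unfolding * by simp
    qed
    moreover have "(\<lambda>N. 2 * (real N)\<^sup>2 * exp (2 - conc_rate / 2 * N)) \<longlonglongrightarrow> 0"
      using conc_rate_pos by real_asymp
    ultimately show ?thesis by simp
  qed
  then have "eventually (\<lambda>N. 1 / \<theta> ^ N * (2 * (real N)\<^sup>2 * small N) < (1 - \<theta>\<^sup>2) / 2) sequentially"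
    by (rule order_tendstoD) (use \<theta>2 in simp)
  ultimately have "eventually (\<lambda>N. t N < \<theta>\<^sup>2 / 4 \<and>
      1 / \<theta> ^ N * (2 * (real N)\<^sup>2 * small N) < (1 - \<theta>\<^sup>2) / 2) sequentially"
    by eventually_elim simp
  then obtain N2 where N2: "\<And>N. N2 \<le> N \<Longrightarrow> t N < \<theta>\<^sup>2 / 4"
    "\<And>N. N2 \<le> N \<Longrightarrow> 1 / \<theta> ^ N * (2 * (real N)\<^sup>2 * small N) < (1 - \<theta>\<^sup>2) / 2"
    unfolding eventually_sequentially by blast
  have "measure_pmf.expectation (coins N) (\<lambda>y. potential \<theta> K N (coupled_next N y A)) \<le> potential \<theta> K N A"
    if N: "max N1 N2 \<le> N" and A: "A \<subseteq> {1..N}" for N A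
  proof -
    consider "card A - (N - card A) \<le> K" | "A = {1..N}" | "K < card A - (N - card A)" "A \<noteq> {1..N}"
      by linarith
    then show ?thesis
    proof cases
      case 1
      have "measure_pmf.expectation (coins N) (\<lambda>y. potential \<theta> K N (coupled_next N y A)) \<le>
          measure_pmf.expectation (coins N) (\<lambda>_. 1)"
        using \<theta> by (intro integral_mono) (auto simp: potential_def power_le_one)
      with 1 show ?thesis by (simp add: potential_def)
    next
      case 2
      then show ?thesis by (simp add: coupled_next_full)
    next
      case 3
      have "card A < N"
        using 3(2) A card_subset_eq[of "{1..N}" A] card_le_interval[OF A] by fastforce
      then have g: "0 < p_gain N A"
        and l: "p_lose N A \<le> (4 * r ^ (card A - (N - card A) - 3) + t N) * p_gain N A"
        and l2: "p_lose2 N A \<le> 2 * (real N)\<^sup>2 * small N * p_gain N A"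
        using rates[of N A] N A 3(1) by auto
      let ?f = "potential \<theta> K N A"
      have f: "0 < ?f" using \<theta> by (simp add: potential_def)
      have "4 * r ^ (card A - (N - card A) - 3) \<le> 4 * r ^ k"
        using r 3(1) by (intro mult_left_mono power_decreasing) (auto simp: K_def)
      then have "4 * r ^ (card A - (N - card A) - 3) + t N \<le> \<theta>\<^sup>2 / 2"
        using k N2(1)[of N] N by simp
      then have "p_lose N A \<le> \<theta>\<^sup>2 / 2 * p_gain N A"
        using g by (intro order_trans[OF l] mult_right_mono) auto
      then have "(1 / \<theta>\<^sup>2 - 1) * p_lose N A \<le> (1 / \<theta>\<^sup>2 - 1) * (\<theta>\<^sup>2 / 2 * p_gain N A)"
        using \<theta>2 by (intro mult_left_mono) auto
      also have "\<dots> = (1 - \<theta>\<^sup>2) / 2 * p_gain N A"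
        using \<theta>2 by (simp add: field_simps)
      finally have b1: "(1 / \<theta>\<^sup>2 - 1) * p_lose N A \<le> (1 - \<theta>\<^sup>2) / 2 * p_gain N A" .
      have "1 / \<theta> ^ N * p_lose2 N A \<le> 1 / \<theta> ^ N * (2 * (real N)\<^sup>2 * small N * p_gain N A)"
        using \<theta> by (intro mult_left_mono l2) auto
      also have "\<dots> = (1 / \<theta> ^ N * (2 * (real N)\<^sup>2 * small N)) * p_gain N A" by simp
      also have "\<dots> \<le> (1 - \<theta>\<^sup>2) / 2 * p_gain N A"
        using N2(2)[of N] N g by (intro mult_right_mono) auto
      finally have b2: "1 / \<theta> ^ N * p_lose2 N A \<le> (1 - \<theta>\<^sup>2) / 2 * p_gain N A" .
      have "- ?f + (?f * (1 - \<theta>\<^sup>2)) * p_gain N A + (- ?f * (1 / \<theta>\<^sup>2 - 1)) * p_lose N A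
          + (- ?f * (1 / \<theta> ^ N)) * p_lose2 N A
          \<le> measure_pmf.expectation (coins N) (\<lambda>y. - potential \<theta> K N (coupled_next N y A))"
      proof (rule expectation_ge_events)
        fix x
        from potential_step[OF \<theta> A 3(1), of x]
        show "- ?f + (?f * (1 - \<theta>\<^sup>2)) * of_bool (A \<inter> flips N x A = {} \<and> flips N x A - A \<noteq> {})
          + (- ?f * (1 / \<theta>\<^sup>2 - 1)) * of_bool (A \<inter> flips N x A \<noteq> {})
          + (- ?f * (1 / \<theta> ^ N)) * of_bool (2 \<le> card (A \<inter> flips N x A))
          \<le> - potential \<theta> K N (next_plus N x A)"
          by (simp only: ring_distribs mult.assoc mult_1_right)
      qed
      moreover have "?f * ((1 / \<theta>\<^sup>2 - 1) * p_lose N A + 1 / \<theta> ^ N * p_lose2 N A)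
          \<le> ?f * ((1 - \<theta>\<^sup>2) * p_gain N A)"
      proof (rule mult_left_mono)
        have "(1 - \<theta>\<^sup>2) * p_gain N A = (1 - \<theta>\<^sup>2) / 2 * p_gain N A + (1 - \<theta>\<^sup>2) / 2 * p_gain N A" by simp
        with b1 b2 show "(1 / \<theta>\<^sup>2 - 1) * p_lose N A + 1 / \<theta> ^ N * p_lose2 N A \<le> (1 - \<theta>\<^sup>2) * p_gain N A"
          by linarith
      qed (use f in simp)
      ultimately show ?thesis by (simp add: algebra_simps)
    qed
  qed
  with \<theta> that show thesis by blast
qed

text \<open>Opinion \<open>-\<close> can only win by bringing the potential up to \<open>1\<close>.\<close>

lemma Win_minority_small:
  obtains \<theta> K N0 where "0 < \<theta>" "\<theta> < 1"
    "\<And>N A. N0 \<le> N \<Longrightarrow> A \<subseteq> {1..N} \<Longrightarrow> Win N ({1..N} - A) \<le> \<theta> ^ (card A - (N - card A) - K)"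
proof -
  obtain \<theta> K N0 where \<theta>: "0 < \<theta>" "\<theta> < 1" and
    sh: "\<And>N A. N0 \<le> N \<Longrightarrow> A \<subseteq> {1..N} \<Longrightarrow>
      measure_pmf.expectation (coins N) (\<lambda>y. potential \<theta> K N (coupled_next N y A)) \<le> potential \<theta> K N A"
    by (rule potential_superharmonic) (rule that)
  have "Win N ({1..N} - A) \<le> \<theta> ^ (card A - (N - card A) - K)" if N: "N0 \<le> N" and A: "A \<subseteq> {1..N}" for N A
  proof -
    have "win N t ({1..N} - A) \<le> potential \<theta> K N A" for t
      using A
    proof (induction t arbitrary: A)
      case 0
      show ?case
      proof (cases "A = {}")
        case True
        then show ?thesis by (simp add: potential_def)
      next
        case False
        then have "{1..N} - A \<noteq> {1..N}" using 0 by blast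
        then show ?thesis using \<theta> by (simp add: potential_def)
      qed
    next
      case (Suc t)
      have "win N (Suc t) ({1..N} - A) =
          measure_pmf.expectation (coins N) (\<lambda>y. win N t ({1..N} - coupled_next N y A))"
        unfolding win_Suc coupled_next_Diff[OF Suc.prems] ..
      also have "\<dots> \<le> measure_pmf.expectation (coins N) (\<lambda>y. potential \<theta> K N (coupled_next N y A))"
        by (intro integral_mono Suc.IH coupled_next_subset) auto
      also have "\<dots> \<le> potential \<theta> K N A"
        by (rule sh[OF N Suc.prems])
      finally show ?case .
    qed
    then show ?thesis
      unfolding potential_def by (intro LIMSEQ_le_const2[OF win_LIMSEQ]) auto
  qed
  with \<theta> that show thesis by blast
qed

section \<open>The advantage of a small lead\<close>

lemma advantage_card_mono:
  assumes "A \<subseteq> {1..N}" "B \<subseteq> {1..N}" "card A \<le> card B"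
  shows "advantage N A \<le> advantage N B"
proof -
  have "Win N ({1..N} - B) \<le> Win N ({1..N} - A)"
    using assms by (intro Win_card_mono) (auto simp: card_Diff_interval)
  with Win_card_mono[OF assms] show ?thesis by (simp add: advantage_def)
qed

lemma advantage_Diff: "A \<subseteq> {1..N} \<Longrightarrow> advantage N ({1..N} - A) = - advantage N A"
  by (simp add: advantage_def double_diff)

lemma advantage_harmonic:
  assumes "A \<subseteq> {1..N}"
  shows "advantage N A = measure_pmf.expectation (coins N) (\<lambda>y. advantage N (coupled_next N y A))"
  unfolding advantage_def coupled_next_Diff[OF assms, symmetric]
  by (simp add: Win_harmonic[of N A] Win_harmonic[of N "{1..N} - A"])

lemma Win_le_1: "Win N A \<le> 1"
  by (rule LIMSEQ_le_const2[OF win_LIMSEQ]) (auto simp: win_le_1)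

lemma advantage_bounds: "- 1 \<le> advantage N A" "advantage N A \<le> 1"
  using Win_nonneg[of N A] Win_nonneg[of N "{1..N} - A"] Win_le_1[of N A] Win_le_1[of N "{1..N} - A"]
  by (auto simp: advantage_def)

text \<open>
  Since the advantage is odd and monotone, losing one vertex out of a strict majority costs at
  most twice the current advantage. Gains are not much rarer than losses, so the advantage of
  a lead is at least a fixed fraction of the advantage of the next larger lead, up to the
  negligible contribution of double losses.
\<close>

lemma advantage_step:
  obtains s N0 where "s \<longlonglongrightarrow> 0"
    "\<And>N A B. N0 \<le> N \<Longrightarrow> A \<subseteq> {1..N} \<Longrightarrow> N < 2 * card A \<Longrightarrow> B \<subseteq> {1..N} \<Longrightarrow> card B = card A + 1 \<Longrightarrow>
      advantage N B - s N \<le> 11 * advantage N A"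
proof -
  obtain r t N1 where r: "0 < r" "r < 1" and t: "t \<longlonglongrightarrow> 0" and
    rates: "\<And>N A. N1 \<le> N \<Longrightarrow> A \<subseteq> {1..N} \<Longrightarrow> N \<le> 2 * card A \<Longrightarrow> card A < N \<Longrightarrow>
       0 < p_gain N A \<and>
       p_lose N A \<le> (4 * r ^ (card A - (N - card A) - 3) + t N) * p_gain N A \<and>
       p_lose2 N A \<le> 2 * (real N)\<^sup>2 * small N * p_gain N A"
    using rates by blast
  define s where "s N = 2 * (real N)\<^sup>2 * small N" for N :: nat
  have "s \<longlonglongrightarrow> 0"
    unfolding s_def small_def using conc_rate_pos by real_asymp
  have "eventually (\<lambda>N. t N < 1) sequentially"
    using t by (intro order_tendstoD(2)) auto
  then obtain N2 where N2: "\<And>N. N2 \<le> N \<Longrightarrow> t N < 1"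
    unfolding eventually_sequentially by blast
  have "advantage N B - s N \<le> 11 * advantage N A"
    if N: "max N1 N2 \<le> N" and A: "A \<subseteq> {1..N}" and maj: "N < 2 * card A"
      and B: "B \<subseteq> {1..N}" "card B = card A + 1" for N A B
  proof -
    let ?u = "advantage N A" and ?u' = "advantage N B"
    have cA: "card A < N" using card_le_interval[OF B(1)] B(2) by simp
    have g: "0 < p_gain N A"
      and l: "p_lose N A \<le> (4 * r ^ (card A - (N - card A) - 3) + t N) * p_gain N A"
      and l2: "p_lose2 N A \<le> s N * p_gain N A"
      using rates[of N A] N A maj cA by (auto simp: s_def)
    have u0: "0 \<le> ?u"
      using advantage_pos[OF A maj] min_atom_pos[of N] by linarith
    have "4 * r ^ (card A - (N - card A) - 3) + t N \<le> 5"
      using N2[of N] N r power_le_one[of r "card A - (N - card A) - 3"] by simp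
    then have l5: "p_lose N A \<le> 5 * p_gain N A"
      using g by (intro order_trans[OF l] mult_right_mono) auto
    have "?u + (?u' - ?u) * p_gain N A + (- 2 * ?u) * p_lose N A + (- 1) * p_lose2 N A
        \<le> measure_pmf.expectation (coins N) (\<lambda>y. advantage N (coupled_next N y A))"
    proof (rule expectation_ge_events)
      fix x
      define u w where "u = card (A \<inter> flips N x A)" and "w = card (flips N x A - A)"
      have fin: "finite A" "finite (flips N x A)" using A by (auto intro: finite_subset simp: flips_def)
      have eq: "card (next_plus N x A) + u = card A + w"
        using card_next_plus[OF A] by (simp add: u_def w_def)
      have zero: "A \<inter> flips N x A = {} \<longleftrightarrow> u = 0" "flips N x A - A = {} \<longleftrightarrow> w = 0"
        using fin by (auto simp: u_def w_def)
      have "?u + (?u' - ?u) * of_bool (u = 0 \<and> w \<noteq> 0) + (- 2 * ?u) * of_bool (u \<noteq> 0)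
          + (- 1) * of_bool (2 \<le> u) \<le> advantage N (next_plus N x A)"
      proof -
        consider "u = 0" "w = 0" | "u = 0" "w \<noteq> 0" | "u = 1" | "2 \<le> u" by linarith
        then show ?thesis
        proof cases
          case 1
          then have "?u \<le> advantage N (next_plus N x A)"
            using eq by (intro advantage_card_mono A next_plus_subset) auto
          with 1 show ?thesis by simp
        next
          case 2
          then have "?u' \<le> advantage N (next_plus N x A)"
            using eq B by (intro advantage_card_mono next_plus_subset) auto
          with 2 show ?thesis by simp
        next
          case 3
          then have "advantage N ({1..N} - A) \<le> advantage N (next_plus N x A)"
            using eq maj by (intro advantage_card_mono next_plus_subset) (auto simp: card_Diff_interval[OF A])
          with 3 show ?thesis by (simp add: advantage_Diff[OF A])
        next
          case 4
          then show ?thesis using u0 advantage_bounds(1)[of N "next_plus N x A"] by simp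
        qed
      qed
      then show "?u + (?u' - ?u) * of_bool (A \<inter> flips N x A = {} \<and> flips N x A - A \<noteq> {})
          + (- 2 * ?u) * of_bool (A \<inter> flips N x A \<noteq> {}) + (- 1) * of_bool (2 \<le> card (A \<inter> flips N x A))
          \<le> advantage N (next_plus N x A)"
        unfolding zero u_def[symmetric] .
    qed
    also have "\<dots> = ?u" by (rule advantage_harmonic[OF A, symmetric])
    finally have "(?u' - ?u) * p_gain N A \<le> 2 * ?u * p_lose N A + p_lose2 N A" by simp
    also have "\<dots> \<le> 2 * ?u * (5 * p_gain N A) + s N * p_gain N A"
      using u0 by (intro add_mono mult_left_mono l5 l2) auto
    also have "\<dots> = (10 * ?u + s N) * p_gain N A" by (simp add: algebra_simps)
    finally show ?thesis using g by (simp add: mult_le_cancel_right)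
  qed
  with \<open>s \<longlonglongrightarrow> 0\<close> that show thesis by blast
qed

lemma advantage_bounded_below:
  obtains c N0 where "0 < c"
    "\<And>N A. N0 \<le> N \<Longrightarrow> A \<subseteq> {1..N} \<Longrightarrow> N < 2 * card A \<Longrightarrow> c \<le> advantage N A"
proof -
  obtain \<theta> K N1 where \<theta>: "0 < \<theta>" "\<theta> < 1" and small:
    "\<And>N A. N1 \<le> N \<Longrightarrow> A \<subseteq> {1..N} \<Longrightarrow> Win N ({1..N} - A) \<le> \<theta> ^ (card A - (N - card A) - K)"
    by (rule Win_minority_small) (rule that)
  have "(\<lambda>k. \<theta> ^ k) \<longlonglongrightarrow> 0" using \<theta> by (intro LIMSEQ_power_zero) auto
  then have "eventually (\<lambda>k. \<theta> ^ k < 1 / 4) sequentially" by (rule order_tendstoD) simp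
  then obtain k where k: "\<theta> ^ k < 1 / 4" unfolding eventually_sequentially by blast
  obtain s N2 where s: "s \<longlonglongrightarrow> 0" and step:
    "\<And>N A B. N2 \<le> N \<Longrightarrow> A \<subseteq> {1..N} \<Longrightarrow> N < 2 * card A \<Longrightarrow> B \<subseteq> {1..N} \<Longrightarrow> card B = card A + 1 \<Longrightarrow>
      advantage N B - s N \<le> 11 * advantage N A"
    using advantage_step by blast
  \<comment> \<open>Downward induction on the lead, starting where the minority wins with probability at most \<open>1/4\<close>.\<close>
  have "\<exists>c>0. \<exists>N0. \<forall>N\<ge>N0. \<forall>A. A \<subseteq> {1..N} \<longrightarrow> N < 2 * card A \<longrightarrow> k + K \<le> card A - (N - card A) + 2 * j
      \<longrightarrow> c \<le> advantage N A" for j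
  proof (induction j)
    case 0
    have "1 / 2 \<le> advantage N A"
      if N: "max N1 3 \<le> N" and A: "A \<subseteq> {1..N}" and lead: "k + K \<le> card A - (N - card A)" for N A
    proof -
      have "\<theta> ^ (card A - (N - card A) - K) \<le> \<theta> ^ k"
        using \<theta> lead by (intro power_decreasing) auto
      with small[of N A] N A k have "Win N ({1..N} - A) \<le> 1 / 4" by simp
      moreover have "Win N A + Win N ({1..N} - A) = 1" using N by (intro Win_complement A) auto
      ultimately show ?thesis by (simp add: advantage_def)
    qed
    then show ?case by (intro exI[of _ "1/2"] conjI exI[of _ "max N1 3"]) auto
  next
    case (Suc j)
    then obtain c N3 where c: "0 < c" and IH: "\<And>N A. N3 \<le> N \<Longrightarrow> A \<subseteq> {1..N} \<Longrightarrow> N < 2 * card A \<Longrightarrow>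
        k + K \<le> card A - (N - card A) + 2 * j \<Longrightarrow> c \<le> advantage N A"
      by blast
    have "eventually (\<lambda>N. s N < c / 2) sequentially"
      using s c by (intro order_tendstoD(2)) auto
    then obtain N4 where N4: "\<And>N. N4 \<le> N \<Longrightarrow> s N < c / 2"
      unfolding eventually_sequentially by blast
    \<comment> \<open>Half of \<open>c\<close> is given up for the double losses, and a factor \<open>11\<close> for the step.\<close>
    have "min (c / 22) 1 \<le> advantage N A"
      if N: "max (max N2 1) (max N3 N4) \<le> N" and A: "A \<subseteq> {1..N}" and maj: "N < 2 * card A"
        and lead: "k + K \<le> card A - (N - card A) + 2 * Suc j" for N A
    proof (cases "A = {1..N}")
      case True
      have "Win N {} = 0"
        using win_LIMSEQ[of N "{}"] N by (simp add: win_empty LIMSEQ_const_iff)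
      with True show ?thesis by (simp add: advantage_def Win_full)
    next
      case False
      then obtain v where v: "v \<in> {1..N}" "v \<notin> A" using A by blast
      have fin: "finite A" using A by (auto intro: finite_subset)
      have B: "insert v A \<subseteq> {1..N}" "card (insert v A) = card A + 1" using A v fin by auto
      have "c \<le> advantage N (insert v A)"
        using N maj lead B card_le_interval[OF B(1)] by (intro IH) auto
      moreover have "advantage N (insert v A) - s N \<le> 11 * advantage N A"
        using N by (intro step A maj B) auto
      moreover have "s N < c / 2" using N by (intro N4) auto
      ultimately show ?thesis by linarith
    qed
    then show ?case
      using c by (intro exI[of _ "min (c / 22) 1"] conjI exI[of _ "max (max N2 1) (max N3 N4)"]) auto
  qed
  from this[of "k + K"] obtain c N0 where "0 < c" "\<And>N A. N0 \<le> N \<Longrightarrow> A \<subseteq> {1..N} \<Longrightarrow> N < 2 * card A \<Longrightarrow>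
      k + K \<le> card A - (N - card A) + 2 * (k + K) \<Longrightarrow> c \<le> advantage N A"
    by blast
  then show thesis using that[of c N0] by simp
qed

text \<open>
  The asymptotic bound leaves out finitely many values of \<open>N\<close>, and each of these has its own
  positive bound.
\<close>

lemma advantage_uniform:
  obtains c where "0 < c"
    "\<And>N A. A \<subseteq> {1..N} \<Longrightarrow> N < 2 * card A \<Longrightarrow> c \<le> advantage N A"
proof -
  obtain c N0 where c: "0 < c" and large:
    "\<And>N A. N0 \<le> N \<Longrightarrow> A \<subseteq> {1..N} \<Longrightarrow> N < 2 * card A \<Longrightarrow> c \<le> advantage N A"
    using advantage_bounded_below by blast
  define c' where "c' = Min (insert c (min_atom ` {..N0}))"
  have "0 < c'"
    unfolding c'_def using c min_atom_pos by (subst Min_gr_iff) auto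
  moreover have "c' \<le> advantage N A" if A: "A \<subseteq> {1..N}" "N < 2 * card A" for N A
  proof (cases "N \<le> N0")
    case True
    then have "c' \<le> min_atom N" unfolding c'_def by (intro Min_le) auto
    with advantage_pos[OF A] show ?thesis by linarith
  next
    case False
    have "c' \<le> c" unfolding c'_def by (intro Min_le) auto
    with large[of N A] A False show ?thesis by linarith
  qed
  ultimately show thesis using that by blast
qed

end

section \<open>The law of the trajectory\<close>

lemma opinions_cong:
  assumes "\<And>s. s < t \<Longrightarrow> \<omega> s = \<omega>' s"
  shows "opinions N W0 \<omega> t = opinions N W0 \<omega>' t"
  using assms by (induction t) auto

lemma opinions_sign:
  assumes "\<And>i. i \<in> {1..N} \<Longrightarrow> W0 i \<in> {-1, 1}" and "i \<in> {1..N}"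
  shows "opinions N W0 \<omega> t i \<in> {-1, 1}"
proof (induction t)
  case (Suc t)
  have "majority N E W i \<in> {-1, 1}" if "W i \<in> {-1, 1}" for E W
    using that by (auto simp: majority_def Let_def sgn_if)
  from this[where W = "opinions N W0 \<omega> t", OF Suc] show ?case by simp
qed (use assms in auto)

lemma measurable_state:
  assumes "{..<t} \<subseteq> I" and "space P = UNIV"
  shows "(\<lambda>\<omega>. g (V_plus N (opinions N W0 \<omega> t))) \<in> PiM I (\<lambda>_. count_space UNIV) \<rightarrow>\<^sub>M P"
proof -
  let ?dec = "\<lambda>xs i. xs ! (i - 1) :: int"
  have "V_plus N W = V_plus N (?dec (map W [1..<Suc N]))" for W
    by (auto simp: V_plus_def simp del: upt_Suc)
  then have "(\<lambda>\<omega>. g (V_plus N (opinions N W0 \<omega> t))) =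
      (\<lambda>xs. g (V_plus N (?dec xs))) \<circ> (\<lambda>\<omega>. map (opinions N W0 \<omega> t) [1..<Suc N])"
    by (simp add: fun_eq_iff del: upt_Suc)
  also have "\<dots> \<in> PiM I (\<lambda>_. count_space UNIV) \<rightarrow>\<^sub>M P"
    by (rule measurable_comp[OF measurable_opinions_upto[OF assms(1)]]) (simp add: assms(2))
  finally show ?thesis .
qed

context homophily
begin

lemma nn_integral_win_step:
  "(\<integral>\<^sup>+B. ennreal (win N s B) \<partial>step N A) = ennreal (win N (Suc s) A)"
proof -
  have "integrable (measure_pmf (step N A)) (win N s)"
    by (rule measure_pmf.integrable_const_bound[where B = 1])
       (auto simp: win_nonneg win_le_1)
  then show ?thesis
    by (simp add: nn_integral_eq_integral win_nonneg win.simps(2))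
qed

lemma nn_integral_SBM:
  assumes "\<And>i. i \<in> {1..N} \<Longrightarrow> W i \<in> {-1, 1}"
  shows "(\<integral>\<^sup>+E. f (V_plus N (majority N E W)) \<partial>SBM p q N W) = (\<integral>\<^sup>+B. f B \<partial>step N (V_plus N W))"
proof -
  have "SBM p q N W = map_pmf (\<lambda>x. {e \<in> vertex_pairs N. x e}) (graph_pmf N (V_plus N W))"
    by (rule SBM_eq_graph_pmf) (rule assms)
  moreover have "V_plus N (majority N {e \<in> vertex_pairs N. x e} W) = next_plus N x (V_plus N W)" for x
    by (rule V_plus_majority) (rule assms)
  ultimately show ?thesis
    by (simp add: step_def)
qed

text \<open>
  The recursion for \<open>win\<close> peels off the first day, the construction of the trajectory the last one;
  a winning probability as integrand reconciles the two.
\<close>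

lemma nn_integral_trajectory:
  fixes N :: nat and W0 :: "nat \<Rightarrow> int"
  assumes W0: "\<And>i. i \<in> {1..N} \<Longrightarrow> W0 i \<in> {-1, 1}"
  shows "(\<integral>\<^sup>+\<omega>. ennreal (win N s (V_plus N (opinions N W0 \<omega> t)))
      \<partial>Ionescu_Tulcea.C (resample p q N W0) (\<lambda>_. count_space UNIV) 0 t (\<lambda>_. undefined)) =
    ennreal (win N (s + t) (V_plus N W0))"
proof -
  interpret IT: Ionescu_Tulcea "resample p q N W0" "\<lambda>_. count_space UNIV"
    by (rule Ionescu_Tulcea_resample)
  let ?M = "\<lambda>_ :: nat. count_space (UNIV :: graph set)"
  have u: "(\<lambda>_. undefined) \<in> space (PiM {0..<0} ?M)" by simp
  show ?thesis
  proof (induction t arbitrary: s)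
    case 0
    have "(\<lambda>\<omega>. ennreal (win N s (V_plus N (opinions N W0 \<omega> 0)))) \<in> borel_measurable (PiM {0..<0} ?M)"
      by (rule measurable_state) auto
    then show ?case by (simp add: nn_integral_return[OF u])
  next
    case (Suc t)
    let ?f = "\<lambda>\<omega>. ennreal (win N s (V_plus N (opinions N W0 \<omega> (Suc t))))"
    have f: "?f \<in> borel_measurable (PiM {0..<Suc t} ?M)"
      by (rule measurable_state) auto
    have "(\<integral>\<^sup>+\<omega>. ?f \<omega> \<partial>IT.C 0 (Suc t) (\<lambda>_. undefined)) =
        (\<integral>\<^sup>+\<omega>. (\<integral>\<^sup>+\<omega>'. ?f \<omega>' \<partial>IT.eP t \<omega>) \<partial>IT.C 0 t (\<lambda>_. undefined))"
      unfolding IT.C.simps add_0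
    proof (rule nn_integral_bind[OF f])
      show "IT.eP t \<in> IT.C 0 t (\<lambda>_. undefined) \<rightarrow>\<^sub>M subprob_algebra (PiM {0..<Suc t} ?M)"
        by (subst measurable_cong_sets[OF IT.sets_C[OF u] refl]) (simp add: IT.measurable_eP)
    qed
    also have "\<dots> = (\<integral>\<^sup>+\<omega>. ennreal (win N (Suc s) (V_plus N (opinions N W0 \<omega> t))) \<partial>IT.C 0 t (\<lambda>_. undefined))"
    proof (rule nn_integral_cong)
      fix \<omega> assume "\<omega> \<in> space (IT.C 0 t (\<lambda>_. undefined))"
      then have \<omega>: "\<omega> \<in> space (PiM {0..<t} ?M)" using IT.space_C[OF u, of t] by simp
      let ?W = "opinions N W0 \<omega> t"
      have "opinions N W0 (fun_upd \<omega> t E) t = ?W" for E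
        by (rule opinions_cong) simp
      then have "(\<integral>\<^sup>+\<omega>'. ?f \<omega>' \<partial>IT.eP t \<omega>) =
          (\<integral>\<^sup>+E. ennreal (win N s (V_plus N (majority N E ?W))) \<partial>resample p q N W0 t \<omega>)"
        by (subst IT.nn_integral_eP[OF \<omega> f]) simp
      also have "\<dots> = (\<integral>\<^sup>+B. ennreal (win N s B) \<partial>step N (V_plus N ?W))"
        unfolding resample_def by (rule nn_integral_SBM) (rule opinions_sign[OF W0])
      finally show "(\<integral>\<^sup>+\<omega>'. ?f \<omega>' \<partial>IT.eP t \<omega>) = ennreal (win N (Suc s) (V_plus N ?W))"
        by (simp add: nn_integral_win_step)
    qed
    also have "\<dots> = ennreal (win N (s + Suc t) (V_plus N W0))"
      using Suc.IH[of "Suc s"] by simp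
    finally show ?case .
  qed
qed

lemma plus_wins_at_eq: "plus_wins_at N W0 t = {\<omega>. V_plus N (opinions N W0 \<omega> t) = {1..N}}"
proof -
  have "card (V_plus N W) = N \<longleftrightarrow> V_plus N W = {1..N}" for W
  proof
    assume "card (V_plus N W) = N"
    then show "V_plus N W = {1..N}" by (intro card_subset_eq) (auto simp: V_plus_def)
  qed simp
  then show ?thesis by (simp add: plus_wins_at_def)
qed

lemma prob_plus_wins_at:
  assumes W0: "\<And>i. i \<in> {1..N} \<Longrightarrow> W0 i \<in> {-1, 1}"
  shows "measure (markovian_model p q N W0) (plus_wins_at N W0 t) = win N t (V_plus N W0)"
proof -
  interpret IT: Ionescu_Tulcea "resample p q N W0" "\<lambda>_. count_space UNIV"
    by (rule Ionescu_Tulcea_resample)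
  let ?M = "\<lambda>_ :: nat. count_space (UNIV :: graph set)"
  let ?J = "{0..<t}"
  have u: "(\<lambda>_. undefined) \<in> space (PiM {0..<0} ?M)" by simp
  have up: "IT.up_to ?J = t"
    using IT.up_to_iff_Ico[of ?J t] IT.up_to[of ?J] by (cases t) (auto simp: ivl_subset)
  define X where "X = {\<omega> \<in> space (PiM ?J ?M). V_plus N (opinions N W0 \<omega> t) = {1..N}}"
  have "(\<lambda>\<omega>. V_plus N (opinions N W0 \<omega> t) = {1..N}) \<in> PiM ?J ?M \<rightarrow>\<^sub>M count_space UNIV"
    by (rule measurable_state) auto
  then have X: "X \<in> sets (PiM ?J ?M)" unfolding X_def by measurable
  have emb: "plus_wins_at N W0 t = IT.PF.emb UNIV ?J X"
    unfolding plus_wins_at_eq X_def prod_emb_def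
  proof (rule set_eqI)
    fix \<omega>
    have "opinions N W0 (restrict \<omega> ?J) t = opinions N W0 \<omega> t"
      by (rule opinions_cong) simp
    then show "\<omega> \<in> {\<omega>. V_plus N (opinions N W0 \<omega> t) = {1..N}} \<longleftrightarrow>
        \<omega> \<in> (\<lambda>x. restrict x ?J) -` {\<omega> \<in> space (PiM ?J ?M). V_plus N (opinions N W0 \<omega> t) = {1..N}}
          \<inter> (\<Pi>\<^sub>E i\<in>UNIV. space (?M i))"
      by (simp add: space_PiM)
  qed
  have C: "sets (IT.C 0 t (\<lambda>_. undefined)) = sets (PiM ?J ?M)"
    "space (IT.C 0 t (\<lambda>_. undefined)) = space (PiM ?J ?M)"
    using IT.sets_C[OF u, of t] IT.space_C[OF u, of t] by simp_all
  have "emeasure (markovian_model p q N W0) (plus_wins_at N W0 t) = emeasure (IT.CI ?J) X"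
    unfolding markovian_model_def emb by (rule IT.lim) (use X in auto)
  also have "\<dots> = emeasure (IT.C 0 t (\<lambda>_. undefined)) ((\<lambda>f. restrict f ?J) -` X \<inter> space (PiM ?J ?M))"
    unfolding IT.CI_def up using X
    by (subst emeasure_distr) (auto simp: C measurable_cong_sets[OF C(1) refl] intro: measurable_restrict_subset)
  also have "(\<lambda>f. restrict f ?J) -` X \<inter> space (PiM ?J ?M) = X"
    by (auto simp: X_def space_PiM PiE_restrict)
  also have "emeasure (IT.C 0 t (\<lambda>_. undefined)) X = (\<integral>\<^sup>+\<omega>. indicator X \<omega> \<partial>IT.C 0 t (\<lambda>_. undefined))"
    using X by (simp add: C)
  also have "\<dots> = (\<integral>\<^sup>+\<omega>. ennreal (win N 0 (V_plus N (opinions N W0 \<omega> t))) \<partial>IT.C 0 t (\<lambda>_. undefined))"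
    by (rule nn_integral_cong) (simp add: X_def C indicator_def)
  also have "\<dots> = ennreal (win N t (V_plus N W0))"
    using nn_integral_trajectory[OF W0, where s = 0] by simp
  finally show ?thesis
    by (simp add: measure_def win_nonneg)
qed

text \<open>
  Winning by a given day implies winning eventually, and \<open>Win\<close> is the limit of the probabilities of
  the former.
\<close>

lemma prob_plus_wins_ge:
  assumes W0: "\<And>i. i \<in> {1..N} \<Longrightarrow> W0 i \<in> {-1, 1}"
  shows "Win N (V_plus N W0) \<le> measure (markovian_model p q N W0) (plus_wins N W0)"
proof (rule LIMSEQ_le_const2[OF win_LIMSEQ], intro exI[of _ 1] allI impI)
  fix t :: nat assume "1 \<le> t"
  interpret prob_space "markovian_model p q N W0" by (rule prob_space_markovian_model)
  have "win N t (V_plus N W0) = prob (plus_wins_at N W0 t)"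
    by (rule prob_plus_wins_at[OF W0, symmetric])
  also have "\<dots> \<le> prob (plus_wins N W0)"
    using \<open>1 \<le> t\<close> by (intro finite_measure_mono plus_wins_measurable) (auto simp: plus_wins_def)
  finally show "win N t (V_plus N W0) \<le> prob (plus_wins N W0)" .
qed

text \<open>The winning probability is \<open>1/2\<close> plus half of the advantage.\<close>

lemma prob_ge_half:
  obtains L :: real where "0 < L"
    "\<And>n \<Delta> W0. 1 \<le> n \<Longrightarrow> 1 \<le> \<Delta> \<Longrightarrow> initial_opinions n \<Delta> W0 \<Longrightarrow>
      1 / 2 + 1 / L \<le> measure (markovian_model p q (2 * n + \<Delta>) W0) (plus_wins (2 * n + \<Delta>) W0)"
proof -
  obtain c where c: "0 < c" and adv: "\<And>N A. A \<subseteq> {1..N} \<Longrightarrow> N < 2 * card A \<Longrightarrow> c \<le> advantage N A"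
    using advantage_uniform by blast
  have "1 / 2 + 1 / (2 / c) \<le> measure (markovian_model p q (2 * n + \<Delta>) W0) (plus_wins (2 * n + \<Delta>) W0)"
    if n: "1 \<le> n" "1 \<le> \<Delta>" and W0: "initial_opinions n \<Delta> W0" for n \<Delta> W0
  proof -
    let ?N = "2 * n + \<Delta>" and ?A = "V_plus (2 * n + \<Delta>) W0"
    have A: "?A \<subseteq> {1..?N}" by (auto simp: V_plus_def)
    have "card ?A = n + \<Delta>" using W0 by (simp add: initial_opinions_def)
    then have "c \<le> advantage ?N ?A" using n by (intro adv A) simp
    moreover have "Win ?N ?A + Win ?N ({1..?N} - ?A) = 1" using n by (intro Win_complement A) simp
    moreover have "Win ?N ?A \<le> measure (markovian_model p q ?N W0) (plus_wins ?N W0)"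
      using W0 by (intro prob_plus_wins_ge) (auto simp: initial_opinions_def)
    ultimately show ?thesis by (simp add: advantage_def field_simps)
  qed
  with c that[of "2 / c"] show thesis by simp
qed

lemma prob_tendsto_1:
  fixes \<Delta> :: "nat \<Rightarrow> nat" and W0 :: "nat \<Rightarrow> nat \<Rightarrow> int"
  assumes init: "\<And>n. 1 \<le> n \<Longrightarrow> initial_opinions n (\<Delta> n) (W0 n)"
    and \<Delta>: "filterlim \<Delta> at_top sequentially"
  shows "(\<lambda>n. measure (markovian_model p q (2 * n + \<Delta> n) (W0 n)) (plus_wins (2 * n + \<Delta> n) (W0 n)))
    \<longlonglongrightarrow> 1"
proof -
  obtain \<theta> K N0 where \<theta>: "0 < \<theta>" "\<theta> < 1" and small:
    "\<And>N A. N0 \<le> N \<Longrightarrow> A \<subseteq> {1..N} \<Longrightarrow> Win N ({1..N} - A) \<le> \<theta> ^ (card A - (N - card A) - K)"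
    by (rule Win_minority_small) (rule that)
  let ?P = "\<lambda>n. measure (markovian_model p q (2 * n + \<Delta> n) (W0 n)) (plus_wins (2 * n + \<Delta> n) (W0 n))"
  have lower: "1 - \<theta> ^ (\<Delta> n - K) \<le> ?P n" if n: "max N0 3 \<le> n" for n
  proof -
    let ?N = "2 * n + \<Delta> n" and ?A = "V_plus (2 * n + \<Delta> n) (W0 n)"
    have W0: "initial_opinions n (\<Delta> n) (W0 n)" using n by (intro init) simp
    have A: "?A \<subseteq> {1..?N}" by (auto simp: V_plus_def)
    have "card ?A = n + \<Delta> n" using W0 by (simp add: initial_opinions_def)
    then have "Win ?N ({1..?N} - ?A) \<le> \<theta> ^ (\<Delta> n - K)"
      using small[OF _ A] n by simp
    moreover have "Win ?N ?A + Win ?N ({1..?N} - ?A) = 1" using n by (intro Win_complement A) simp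
    moreover have "Win ?N ?A \<le> ?P n"
      using W0 by (intro prob_plus_wins_ge) (auto simp: initial_opinions_def)
    ultimately show ?thesis by linarith
  qed
  have "filterlim (\<lambda>n. \<Delta> n - K) at_top sequentially"
    using filterlim_compose[OF filterlim_minus_const_nat_at_top \<Delta>] .
  then have "(\<lambda>n. \<theta> ^ (\<Delta> n - K)) \<longlonglongrightarrow> 0"
    by (rule filterlim_compose[rotated]) (use \<theta> in \<open>auto intro: LIMSEQ_power_zero\<close>)
  then have "(\<lambda>n. 1 - \<theta> ^ (\<Delta> n - K)) \<longlonglongrightarrow> 1 - 0" by (intro tendsto_intros)
  then have lim: "(\<lambda>n. 1 - \<theta> ^ (\<Delta> n - K)) \<longlonglongrightarrow> 1" by simp
  show ?thesis
  proof (rule tendsto_sandwich[OF _ _ lim tendsto_const])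
    show "\<forall>\<^sub>F n in sequentially. 1 - \<theta> ^ (\<Delta> n - K) \<le> ?P n"
      using lower unfolding eventually_sequentially by blast
    show "\<forall>\<^sub>F n in sequentially. ?P n \<le> 1"
      by (intro always_eventually allI prob_space.prob_le_1 prob_space_markovian_model)
  qed
qed

end

theorem theorem1:
  fixes p q :: real
  assumes "0 < q" and "q < p" and "p \<le> 1"
  shows "(\<exists>L::real. L > 0 \<and>
            (\<forall>n \<Delta> W0. n \<ge> 1 \<longrightarrow> \<Delta> \<ge> 1 \<longrightarrow> initial_opinions n \<Delta> W0 \<longrightarrow>
               measure (markovian_model p q (2 * n + \<Delta>) W0) (plus_wins (2 * n + \<Delta>) W0)
                 \<ge> 1 / 2 + 1 / L)) \<and>
         (\<forall>\<Delta> :: nat \<Rightarrow> nat. \<forall>W0 :: nat \<Rightarrow> nat \<Rightarrow> int.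
            (\<forall>n\<ge>1. \<Delta> n \<ge> 1 \<and> initial_opinions n (\<Delta> n) (W0 n)) \<longrightarrow>
            filterlim \<Delta> at_top sequentially \<longrightarrow>
            (\<lambda>n. measure (markovian_model p q (2 * n + \<Delta> n) (W0 n))
                   (plus_wins (2 * n + \<Delta> n) (W0 n))) \<longlonglongrightarrow> 1)"
proof -
  interpret homophily p q by unfold_locales (rule assms)+
  obtain L :: real where "0 < L"
    "\<And>n \<Delta> W0. 1 \<le> n \<Longrightarrow> 1 \<le> \<Delta> \<Longrightarrow> initial_opinions n \<Delta> W0 \<Longrightarrow>
      1 / 2 + 1 / L \<le> measure (markovian_model p q (2 * n + \<Delta>) W0) (plus_wins (2 * n + \<Delta>) W0)"
    using prob_ge_half by blast
  moreover have "(\<lambda>n. measure (markovian_model p q (2 * n + \<Delta> n) (W0 n))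
      (plus_wins (2 * n + \<Delta> n) (W0 n))) \<longlonglongrightarrow> 1"
    if "\<forall>n\<ge>1. \<Delta> n \<ge> 1 \<and> initial_opinions n (\<Delta> n) (W0 n)" "filterlim \<Delta> at_top sequentially"
    for \<Delta> :: "nat \<Rightarrow> nat" and W0 :: "nat \<Rightarrow> nat \<Rightarrow> int"
    using that by (intro prob_tendsto_1) auto
  ultimately show ?thesis by blast
qed

end
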